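(* Assume that $f\colon[0,1]\to\mathbb{R}$ is Lipschitz continuous. Let $\Theta=(\Theta_1,\Theta_2,\Theta_3)\colon[0,\infty)\to\mathbb{R}^3$ be a gradient flow trajectory with $\Theta(0)\in M$ and $\Theta(t)=\Theta(0)-\int_0^t\mathfrak{G}(\Theta(u))\,\mathrm{d}u$ for all $t\in[0,\infty)$. Then $\sup_{t\in[0,\infty)}\|\Theta(t)\|<\infty$.
   Context: Let $f\in C([0,1],\mathbb{R})$ and $\overline{f}=\int_0^1 f(x)\,\mathrm{d}x$. For $\theta=(\theta_1,\theta_2,\theta_3)\in\mathbb{R}^3$ let $m(\theta)=\int_0^1\max\{\theta_1 s+\theta_2,0\}\,\mathrm{d}s$, $$\mathcal{L}(\theta)=\int_0^1\bigl(\theta_3(\max\{\theta_1 s+\theta_2,0\}-m(\theta))+\overline{f}-f(s)\bigr)^2\,\mathrm{d}s,$$ $g(\theta)=|\theta_1|^2+|\theta_2|^2$, and $M=g^{-1}(1)=\{\theta\in\mathbb{R}^3: g(\theta)=1\}$. The function $\mathcal{L}$ is continuously differentiable on $\{\theta\in\mathbb{R}^3:|\theta_1|+|\theta_2|>0\}$. Let $\mathfrak{G}\colon\mathbb{R}^3\to\mathbb{R}^3$ be a locally bounded and measurable function which satisfies for all $\theta\in\mathbb{R}^3$ with $|\theta_1|+|\theta_2|>0$ that $$\mathfrak{G}(\theta)=\nabla\mathcal{L}(\theta)-\|\nabla g(\theta)\|^{-2}\langle\nabla\mathcal{L}(\theta),\nabla g(\theta)\rangle\nabla g(\theta).$$ Here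 $\|\cdot\|$ and $\langle\cdot,\cdot\rangle$ are the Euclidean norm and inner product. *)

theory Defs
  imports "HOL-Analysis.Analysis"
begin

text \<open>The value is unspecified where \<open>F\<close> is not differentiable.\<close>

definition grad :: "('a::real_inner \<Rightarrow> real) \<Rightarrow> 'a \<Rightarrow> 'a" where
  "grad F x = (THE D. GDERIV F x :> D)"

lemma grad_eqI:
  assumes "GDERIV F x :> D"
  shows "grad F x = D"
proof -
  have "D' = D" if "GDERIV F x :> D'" for D'
  proof -
    have "(\<lambda>h. h \<bullet> D') = (\<lambda>h. h \<bullet> D)"
      using that assms unfolding gderiv_def by (rule has_derivative_unique)
    then have "\<forall>h. h \<bullet> D' = h \<bullet> D" by metis
    then show ?thesis by (metis inner_commute vector_eq_rdot)
  qed
  with assms show ?thesis unfolding grad_def by blast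
qed

text \<open>A function on \<open>[0,1]\<close> is encoded as a total function \<open>real \<Rightarrow> real\<close>; its values
  outside \<open>{0..1}\<close> are never used below.\<close>

definition fmean :: "(real \<Rightarrow> real) \<Rightarrow> real" where
  "fmean f = integral {0..1} f"

definition neuron :: "real^3 \<Rightarrow> real \<Rightarrow> real" where
  "neuron \<theta> s = max (\<theta>$1 * s + \<theta>$2) 0"

definition neuron_mean :: "real^3 \<Rightarrow> real" where
  "neuron_mean \<theta> = integral {0..1} (\<lambda>s. neuron \<theta> s)"

definition risk :: "(real \<Rightarrow> real) \<Rightarrow> real^3 \<Rightarrow> real" where
  "risk f \<theta> =
    integral {0..1} (\<lambda>s. (\<theta>$3 * (neuron \<theta> s - neuron_mean \<theta>) + fmean f - f s)\<^sup>2)"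

definition inner_sq :: "real^3 \<Rightarrow> real" where
  "inner_sq \<theta> = \<bar>\<theta>$1\<bar>\<^sup>2 + \<bar>\<theta>$2\<bar>\<^sup>2"

definition norm_manifold :: "(real^3) set" where
  "norm_manifold = inner_sq -` {1}"

definition locally_bounded :: "('a::topological_space \<Rightarrow> 'b::metric_space) \<Rightarrow> bool" where
  "locally_bounded G \<longleftrightarrow> (\<forall>x. \<exists>U. open U \<and> x \<in> U \<and> bounded (G ` U))"

text \<open>Absolute integrability is the existence of the Lebesgue integral in the flow equation
  (\<open>integral\<close> is \<open>0\<close> on non-integrable functions). Together with that equation it makes
  \<open>\<Theta>\<close> continuous on \<open>{0..}\<close>; conversely, it is automatic for continuous \<open>\<Theta>\<close> when \<open>G\<close> is
  Borel measurable and locally bounded.\<close>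

definition gradient_flow :: "('a::euclidean_space \<Rightarrow> 'a) \<Rightarrow> (real \<Rightarrow> 'a) \<Rightarrow> bool" where
  "gradient_flow G \<Theta> \<longleftrightarrow>
    (\<forall>t\<ge>0. (\<lambda>u. G (\<Theta> u)) absolutely_integrable_on {0..t} \<and>
           \<Theta> t = \<Theta> 0 - integral {0..t} (\<lambda>u. G (\<Theta> u)))"

end

theory Submission
  imports Defs
begin

text \<open>
  Write \<open>(w, b, c)\<close> for the parameters, \<open>F = f - fmean f\<close> for the centred target, \<open>V\<close> for the variance
  of the neuron on \<open>[0,1]\<close> and \<open>A\<close> for its correlation with \<open>F\<close>. Up to a constant the risk is
  \<open>c\<^sup>2 V - 2 c A\<close>. The flow stays on the cylinder \<open>w\<^sup>2 + b\<^sup>2 = 1\<close> and decreases the risk, so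
  \<open>c\<^sup>2 V\<close> stays bounded, and \<open>c\<close> can be large only where \<open>V\<close> is small: near \<open>(0, 1)\<close>, where the neuron
  is active on all of \<open>[0,1]\<close>, or near the arc where it is inactive. Near \<open>(0, 1)\<close> the risk depends on
  \<open>c w\<close> only and \<open>c\<^sup>2 + 2 ln b\<close> is conserved. Near the inactive arc the neuron is supported next to
  one endpoint of \<open>[0,1]\<close>; let \<open>d\<close> be its value there and \<open>k\<close> the value of \<open>F\<close>. By the Lipschitz
  condition \<open>c\<close> can grow only if \<open>c d < 8 k / 5\<close>, at a rate of order \<open>d\<^sup>2\<close>, whereas \<open>c d\<close> grows at a
  rate of order \<open>c\<^sup>2 d\<close> as long as \<open>c d < 9 k / 5\<close>. Hence adding to \<open>c\<close> a bounded function of \<open>c d\<close>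
  that decreases up to \<open>c d = 9 k / 5\<close> gives a Lyapunov function. The lower bound for \<open>c\<close> follows by
  replacing \<open>(c, F)\<close> with \<open>(- c, - F)\<close>.
\<close>

section \<open>Integrals of a function with a kink\<close>

text \<open>Dominated convergence along the filter \<open>at x\<close>, reduced to sequences. The
  exceptional null set \<open>Z\<close> is cut out of the interval first, so pointwise convergence
  may fail at the kink of a neuron.\<close>

lemma integral_tendsto_bounded:
  fixes g :: "'a::first_countable_topology \<Rightarrow> real \<Rightarrow> real"
  assumes S: "open S" "x \<in> S" and Z: "negligible Z"
    and int: "\<And>y. y \<in> S \<Longrightarrow> g y integrable_on {a..b}"
    and bd: "\<And>y s. y \<in> S \<Longrightarrow> s \<in> {a..b} \<Longrightarrow> \<bar>g y s\<bar> \<le> B"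
    and lim: "\<And>s. s \<in> {a..b} - Z \<Longrightarrow> ((\<lambda>y. g y s) \<longlongrightarrow> l s) (at x)"
  shows "((\<lambda>y. integral {a..b} (g y)) \<longlongrightarrow> integral {a..b} l) (at x)"
proof -
  have neg: "negligible (({a..b} - Z - {a..b}) \<union> ({a..b} - ({a..b} - Z)))"
    by (rule negligible_subset[OF Z]) auto
  have spike: "integral ({a..b} - Z) h = integral {a..b} h"
    "h integrable_on ({a..b} - Z) \<longleftrightarrow> h integrable_on {a..b}" for h :: "real \<Rightarrow> real"
    subgoal by (rule integral_spike_set; rule negligible_subset[OF neg]; auto)
    subgoal by (rule integrable_spike_set_eq[OF neg])
    done
  have "((\<lambda>y. integral {a..b} (g y)) \<longlongrightarrow> integral {a..b} l) (at x within S)"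
    unfolding tendsto_at_iff_sequentially comp_def
  proof safe
    fix X assume X: "\<forall>i. X i \<in> S - {x}" "X \<longlonglongrightarrow> x"
    have "(\<lambda>n. integral ({a..b} - Z) (g (X n))) \<longlonglongrightarrow> integral ({a..b} - Z) l"
    proof (rule dominated_convergence(2)[where h="\<lambda>_. B"])
      show "(\<lambda>_. B) integrable_on {a..b} - Z" unfolding spike by (rule integrable_const_ivl)
      have XS: "X k \<in> S" "X k \<noteq> x" for k using X by auto
      show "g (X k) integrable_on {a..b} - Z" for k unfolding spike by (rule int[OF XS(1)])
      show "norm (g (X k) s) \<le> B" if "s \<in> {a..b} - Z" for k s
        using bd[OF XS(1)] that by simp
      show "(\<lambda>k. g (X k) s) \<longlonglongrightarrow> l s" if "s \<in> {a..b} - Z" for s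
      proof (rule filterlim_compose[OF lim[OF that]])
        show "filterlim X (at x) sequentially"
          using X(2) XS(2) by (simp add: filterlim_at)
      qed
    qed
    then show "(\<lambda>n. integral {a..b} (g (X n))) \<longlonglongrightarrow> integral {a..b} l" unfolding spike .
  qed
  then show ?thesis unfolding at_within_open[OF S(2,1)] .
qed

text \<open>Common frame for the ReLU and its square: \<open>\<phi>'\<close> is the derivative off
  \<open>0\<close>, with an arbitrary value at \<open>0\<close> within the bound. The local
  Lipschitz constant also bounds \<open>\<phi>'\<close> and serves as the dominating constant when
  differentiating under the integral.\<close>

definition kinked :: "(real \<Rightarrow> real) \<Rightarrow> (real \<Rightarrow> real) \<Rightarrow> bool" where
  "kinked \<phi> \<phi>' \<longleftrightarrow> \<phi>' \<in> borel_measurable borel \<and>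
    (\<forall>y. y \<noteq> 0 \<longrightarrow> (\<phi> has_real_derivative \<phi>' y) (at y) \<and> isCont \<phi>' y) \<and>
    (\<forall>M. \<exists>B. \<forall>y z. \<bar>y\<bar> \<le> M \<longrightarrow> \<bar>z\<bar> \<le> M \<longrightarrow> \<bar>\<phi>' y\<bar> \<le> B \<and> \<bar>\<phi> y - \<phi> z\<bar> \<le> B * \<bar>y - z\<bar>)"

lemma kinked_bound:
  assumes "kinked \<phi> \<phi>'"
  shows "\<exists>B. \<forall>y z. \<bar>y\<bar> \<le> M \<longrightarrow> \<bar>z\<bar> \<le> M \<longrightarrow> \<bar>\<phi>' y\<bar> \<le> B \<and> \<bar>\<phi> y - \<phi> z\<bar> \<le> B * \<bar>y - z\<bar>"
  using assms unfolding kinked_def by blast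

lemma continuous_Icc_bounded:
  fixes k :: "real \<Rightarrow> real"
  assumes "continuous_on {a..b} k"
  shows "\<exists>K. \<forall>s\<in>{a..b}. \<bar>k s\<bar> \<le> K"
proof -
  have "bounded (k ` {a..b})" using assms by (intro compact_imp_bounded compact_continuous_image) auto
  then show ?thesis by (simp add: bounded_iff)
qed

text \<open>The value at the kink is \<open>0\<close>, so that \<open>step\<close> vanishes on all
  of \<open>y \<le> 0\<close>, as \<open>pint_end\<close> requires.\<close>

definition step :: "real \<Rightarrow> real" where "step y = of_bool (0 < y)"

lemma kinked_relu: "kinked (\<lambda>y. max y 0) step"
  unfolding kinked_def
proof (intro conjI allI impI)
  show "step \<in> borel_measurable borel" unfolding step_def by measurable
  fix y :: real assume y: "y \<noteq> 0"
  show "((\<lambda>y. max y 0) has_real_derivative step y) (at y)"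
  proof (cases "y > 0")
    case True
    have "((\<lambda>y. max y 0) has_real_derivative 1) (at y)"
      using True by (intro has_field_derivative_transform_within_open[OF DERIV_ident, of "{0<..}"]) auto
    then show ?thesis using True by (simp add: step_def)
  next
    case False
    have "((\<lambda>y. max y 0) has_real_derivative 0) (at y)"
      using False y by (intro has_field_derivative_transform_within_open[OF DERIV_const, of "{..<0}"]) auto
    then show ?thesis using False by (simp add: step_def)
  qed
  show "isCont step y"
  proof (cases "y > 0")
    case True
    have "eventually (\<lambda>z. z > 0) (nhds y)" using True by (intro eventually_nhds_in_open[of "{0<..}", simplified]) auto
    then have "eventually (\<lambda>z. step z = 1) (nhds y)" by eventually_elim (simp add: step_def)
    then show ?thesis using isCont_cong[of step "\<lambda>_. 1" y] by simp
  next
    case False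
    then have "eventually (\<lambda>z. z < 0) (nhds y)" using y by (intro eventually_nhds_in_open[of "{..<0}", simplified]) auto
    then have "eventually (\<lambda>z. step z = 0) (nhds y)" by eventually_elim (simp add: step_def)
    then show ?thesis using isCont_cong[of step "\<lambda>_. 0" y] by simp
  qed
next
  fix M show "\<exists>B. \<forall>y z. \<bar>y\<bar> \<le> M \<longrightarrow> \<bar>z\<bar> \<le> M \<longrightarrow> \<bar>step y\<bar> \<le> B \<and> \<bar>max y 0 - max z 0\<bar> \<le> B * \<bar>y - z\<bar>"
    by (rule exI[of _ 1]) (auto simp: step_def)
qed

text \<open>Squaring removes the kink: at \<open>0\<close> the difference quotient is at most
  \<open>\<bar>h\<bar>\<close>. The squared positive part later serves as a differentiable cut-off,
  in the Lyapunov function and in the proof that the circle is invariant.\<close>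

lemma DERIV_relu_sq: "((\<lambda>y. (max y 0)\<^sup>2) has_real_derivative 2 * max y 0) (at y)" for y :: real
proof (cases "y = 0")
  case False
  then have "((\<lambda>y. max y 0) has_real_derivative step y) (at y)"
    using kinked_relu by (auto simp: kinked_def)
  from DERIV_power[OF this, of 2] show ?thesis
    by (auto simp: step_def power2_eq_square max_def)
next
  case True
  have "((\<lambda>h. (max h 0)\<^sup>2 / h) \<longlongrightarrow> 0) (at (0::real))"
  proof (rule Lim_null_comparison)
    show "((\<lambda>h. \<bar>h\<bar>) \<longlongrightarrow> 0) (at (0::real))" by (auto intro!: tendsto_eq_intros)
    show "\<forall>\<^sub>F h in at 0. norm ((max h 0)\<^sup>2 / h) \<le> \<bar>h\<bar>" for h :: real
      by (rule always_eventually) (auto simp: max_def power2_eq_square)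
  qed
  then show ?thesis using True by (simp add: DERIV_def)
qed

lemma kinked_relu_sq: "kinked (\<lambda>y. (max y 0)\<^sup>2) (\<lambda>y. 2 * max y 0)"
  unfolding kinked_def
proof (intro conjI allI impI)
  show "((\<lambda>y. (max y 0)\<^sup>2) has_real_derivative 2 * max y 0) (at y)" for y :: real
    by (rule DERIV_relu_sq)
  fix M :: real
  have "\<bar>(max y 0)\<^sup>2 - (max z 0)\<^sup>2\<bar> \<le> 2 * M * \<bar>y - z\<bar>" if "\<bar>y\<bar> \<le> M" "\<bar>z\<bar> \<le> M" for y z
  proof -
    have "\<bar>(max y 0)\<^sup>2 - (max z 0)\<^sup>2\<bar> = \<bar>max y 0 + max z 0\<bar> * \<bar>max y 0 - max z 0\<bar>"
      unfolding abs_mult[symmetric] by (simp add: power2_eq_square algebra_simps)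
    also have "\<dots> \<le> (2 * M) * \<bar>y - z\<bar>" using that by (intro mult_mono) auto
    finally show ?thesis .
  qed
  then show "\<exists>B. \<forall>y z. \<bar>y\<bar> \<le> M \<longrightarrow> \<bar>z\<bar> \<le> M \<longrightarrow>
      \<bar>2 * max y 0\<bar> \<le> B \<and> \<bar>(max y 0)\<^sup>2 - (max z 0)\<^sup>2\<bar> \<le> B * \<bar>y - z\<bar>"
    by (intro exI[of _ "2 * M"]) auto
qed (auto intro!: continuous_intros)

text \<open>Off \<open>0\<close> this follows from differentiability; at \<open>0\<close> only the
  local Lipschitz bound is available.\<close>

lemma kinked_continuous:
  assumes "kinked \<phi> \<phi>'" shows "continuous_on UNIV \<phi>"
proof -
  have "isCont \<phi> y" for y
  proof (cases "y = 0")
    case True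
    obtain B where B: "\<And>z. \<bar>z\<bar> \<le> 1 \<Longrightarrow> \<bar>\<phi> z - \<phi> 0\<bar> \<le> B * \<bar>z\<bar>"
      using assms unfolding kinked_def by (metis abs_zero diff_zero zero_le_one)
    have "((\<lambda>z. \<phi> z - \<phi> 0) \<longlongrightarrow> 0) (at 0)"
    proof (rule Lim_null_comparison)
      show "((\<lambda>z. B * \<bar>z\<bar>) \<longlongrightarrow> 0) (at (0::real))" by (auto intro!: tendsto_eq_intros)
      have "eventually (\<lambda>z::real. z \<in> ball 0 1) (nhds 0)" by (intro eventually_nhds_in_open) auto
      then show "\<forall>\<^sub>F z in at 0. norm (\<phi> z - \<phi> 0) \<le> B * \<bar>z\<bar>"
        by (auto simp: eventually_at_filter dist_real_def elim!: eventually_mono intro!: B)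
    qed
    then show ?thesis using True by (simp add: isCont_def LIM_zero_iff)
  next
    case False
    then show ?thesis using assms unfolding kinked_def by (blast intro: DERIV_isCont)
  qed
  then show ?thesis by (simp add: continuous_on_eq_continuous_at)
qed

section \<open>Integrals of a kinked function of the affine preactivation, with a weight\<close>

definition pint :: "(real \<Rightarrow> real) \<Rightarrow> (real \<Rightarrow> real) \<Rightarrow> real \<Rightarrow> real \<Rightarrow> real" where
  "pint \<phi> k w b = integral {0..1} (\<lambda>s. \<phi> (w * s + b) * k s)"

lemma integrable_continuous_mult_borel:
  fixes k \<phi> :: "real \<Rightarrow> real"
  assumes k: "continuous_on {0..1} k" and m: "\<phi> \<in> borel_measurable borel"
    and B: "\<And>s. s \<in> {0..1} \<Longrightarrow> \<bar>\<phi> (w * s + b)\<bar> \<le> B"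
  shows "(\<lambda>s. \<phi> (w * s + b) * k s) integrable_on {0..1}"
proof (rule measurable_bounded_by_integrable_imp_integrable)
  show "(\<lambda>s. \<phi> (w * s + b) * k s) \<in> borel_measurable (lebesgue_on {0..1})"
  proof (rule borel_measurable_times)
    have "(\<lambda>s. \<phi> (w * s + b)) \<in> borel_measurable borel" using m by measurable
    then show "(\<lambda>s. \<phi> (w * s + b)) \<in> borel_measurable (lebesgue_on {0..1})"
      by (intro measurable_restrict_space1 measurable_completion) simp
    show "k \<in> borel_measurable (lebesgue_on {0..1})"
      using k by (intro continuous_imp_measurable_on_sets_lebesgue) auto
  qed
  show "(\<lambda>s. B * \<bar>k s\<bar>) integrable_on {0..1}"
    using k by (intro integrable_continuous_interval continuous_intros)
  show "norm (\<phi> (w * s + b) * k s) \<le> B * \<bar>k s\<bar>" if "s \<in> {0..1}" for s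
    using B[OF that] by (auto simp: abs_mult intro: mult_right_mono)
qed auto

lemma affine_bound:
  fixes w b :: real
  assumes "\<bar>w\<bar> \<le> r" "\<bar>b\<bar> \<le> r" "s \<in> {0..1}"
  shows "\<bar>w * s + b\<bar> \<le> 2 * r"
proof -
  have "\<bar>w * s\<bar> \<le> r * 1" unfolding abs_mult using assms by (intro mult_mono) auto
  then show ?thesis using assms(2) by linarith
qed

lemma kinked_integrable:
  assumes "kinked \<phi> \<phi>'" "continuous_on {0..1} k"
  shows "(\<lambda>s. \<phi> (w * s + b) * k s) integrable_on {0..1}"
    "(\<lambda>s. \<phi>' (w * s + b) * k s) integrable_on {0..1}"
proof -
  have "continuous_on {0..1} (\<lambda>s. \<phi> (w * s + b))"
    by (intro continuous_on_compose2[OF kinked_continuous[OF assms(1)]] continuous_intros) auto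
  then show "(\<lambda>s. \<phi> (w * s + b) * k s) integrable_on {0..1}"
    using assms(2) by (intro integrable_continuous_interval continuous_intros)
  obtain B where B [rule_format]: "\<forall>y z. \<bar>y\<bar> \<le> 2 * max \<bar>w\<bar> \<bar>b\<bar> \<longrightarrow> \<bar>z\<bar> \<le> 2 * max \<bar>w\<bar> \<bar>b\<bar> \<longrightarrow>
      \<bar>\<phi>' y\<bar> \<le> B \<and> \<bar>\<phi> y - \<phi> z\<bar> \<le> B * \<bar>y - z\<bar>"
    using kinked_bound[OF assms(1)] by (rule exE)
  show "(\<lambda>s. \<phi>' (w * s + b) * k s) integrable_on {0..1}"
  proof (rule integrable_continuous_mult_borel[OF assms(2)])
    show "\<phi>' \<in> borel_measurable borel" using assms(1) by (simp add: kinked_def)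
    show "\<bar>\<phi>' (w * s + b)\<bar> \<le> B" if "s \<in> {0..1}" for s
      using B affine_bound[OF _ _ that, of w "max \<bar>w\<bar> \<bar>b\<bar>" b] by simp
  qed
qed

lemma negligible_kink:
  fixes w b :: real
  assumes "w \<noteq> 0 \<or> b \<noteq> 0"
  shows "negligible {s. w * s + b = 0}"
proof (rule negligible_subset)
  \<comment> \<open>For \<open>w = 0\<close> the quotient is \<open>0\<close> by convention, and the
    kink set is empty because then \<open>b \<noteq> 0\<close>.\<close>
  show "negligible {- b / w}" by simp
  show "{s. w * s + b = 0} \<subseteq> {- b / w}"
    using assms by (cases "w = 0") (auto simp: field_simps eq_neg_iff_add_eq_0)
qed

text \<open>Dominated convergence: away from \<open>w = b = 0\<close> the integrand converges except
  where \<open>\<theta>$1 * s + \<theta>$2 = 0\<close>, a null set, although \<open>\<phi>'\<close>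
  may jump.\<close>

lemma continuous_pint_deriv:
  fixes \<theta> :: "real^3"
  assumes \<phi>: "kinked \<phi> \<phi>'" and k: "continuous_on {0..1} k" and nz: "\<theta>$1 \<noteq> 0 \<or> \<theta>$2 \<noteq> 0"
  shows "isCont (\<lambda>\<theta>. pint \<phi>' k (\<theta>$1) (\<theta>$2)) \<theta>"
proof -
  obtain K where K [rule_format]: "\<forall>s\<in>{0..1}. \<bar>k s\<bar> \<le> K"
    using continuous_Icc_bounded[OF k] by (rule exE)
  obtain B where B [rule_format]: "\<forall>y z. \<bar>y\<bar> \<le> 2 * (norm \<theta> + 1) \<longrightarrow> \<bar>z\<bar> \<le> 2 * (norm \<theta> + 1) \<longrightarrow>
      \<bar>\<phi>' y\<bar> \<le> B \<and> \<bar>\<phi> y - \<phi> z\<bar> \<le> B * \<bar>y - z\<bar>"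
    using kinked_bound[OF \<phi>] by (rule exE)
  show ?thesis
    unfolding isCont_def pint_def
  proof (rule integral_tendsto_bounded[OF _ _ negligible_kink[OF nz], of "ball \<theta> 1"])
    fix y :: "real^3" assume y: "y \<in> ball \<theta> 1"
    have n: "\<bar>y$i\<bar> \<le> norm \<theta> + 1" for i
    proof -
      have "\<bar>y$i\<bar> \<le> norm y" by (rule component_le_norm_cart)
      also have "\<dots> \<le> norm \<theta> + 1" using y norm_triangle_ineq2[of y \<theta>] by (simp add: dist_norm norm_minus_commute)
      finally show ?thesis .
    qed
    show "(\<lambda>s. \<phi>' (y$1 * s + y$2) * k s) integrable_on {0..1}" by (rule kinked_integrable[OF \<phi> k])
    fix s :: real assume s: "s \<in> {0..1}"
    show "\<bar>\<phi>' (y$1 * s + y$2) * k s\<bar> \<le> B * K"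
    proof -
      have "\<bar>\<phi>' (y$1 * s + y$2)\<bar> \<le> B"
        using affine_bound[OF n n s, of 1 2] B by blast
      then show ?thesis unfolding abs_mult using K[OF s] by (intro mult_mono) auto
    qed
  next
    fix s assume "s \<in> {0..1} - {s. \<theta>$1 * s + \<theta>$2 = 0}"
    then have "isCont \<phi>' (\<theta>$1 * s + \<theta>$2)" using \<phi> unfolding kinked_def by blast
    then show "((\<lambda>y. \<phi>' (y$1 * s + y$2) * k s) \<longlongrightarrow> \<phi>' (\<theta>$1 * s + \<theta>$2) * k s) (at \<theta>)"
      by (intro tendsto_intros isCont_tendsto_compose[where g=\<phi>'])
  qed auto
qed

text \<open>Differentiation under the integral sign. The remainder integrand divided by
  \<open>norm h\<close> tends to \<open>0\<close> off the kink; it is bounded by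
  \<open>4 * B * K\<close>, since the increment of \<open>\<phi>\<close> and the linear term
  contribute at most \<open>2 * B * norm h\<close> each.\<close>

lemma pint_has_derivative:
  fixes \<theta> :: "real^3"
  assumes \<phi>: "kinked \<phi> \<phi>'" and k: "continuous_on {0..1} k" and nz: "\<theta>$1 \<noteq> 0 \<or> \<theta>$2 \<noteq> 0"
  shows "((\<lambda>\<theta>. pint \<phi> k (\<theta>$1) (\<theta>$2)) has_derivative
    (\<lambda>h. h$1 * pint \<phi>' (\<lambda>s. s * k s) (\<theta>$1) (\<theta>$2) + h$2 * pint \<phi>' k (\<theta>$1) (\<theta>$2))) (at \<theta>)"
    (is "(?f has_derivative ?D) _")
proof -
  obtain K where K [rule_format]: "\<forall>s\<in>{0..1}. \<bar>k s\<bar> \<le> K"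
    using continuous_Icc_bounded[OF k] by (rule exE)
  obtain B where B [rule_format]: "\<forall>y z. \<bar>y\<bar> \<le> 2 * (norm \<theta> + 1) \<longrightarrow> \<bar>z\<bar> \<le> 2 * (norm \<theta> + 1) \<longrightarrow>
      \<bar>\<phi>' y\<bar> \<le> B \<and> \<bar>\<phi> y - \<phi> z\<bar> \<le> B * \<bar>y - z\<bar>"
    using kinked_bound[OF \<phi>] by (rule exE)
  define E where "E h s = (\<phi> ((\<theta> + h)$1 * s + (\<theta> + h)$2) * k s - \<phi> (\<theta>$1 * s + \<theta>$2) * k s
      - (h$1 * (\<phi>' (\<theta>$1 * s + \<theta>$2) * (s * k s)) + h$2 * (\<phi>' (\<theta>$1 * s + \<theta>$2) * k s)))" for h s
  have sk: "continuous_on {0..1} (\<lambda>s. s * k s)" using k by (intro continuous_intros)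
  note ints = kinked_integrable(1)[OF \<phi> k] kinked_integrable(2)[OF \<phi> k] kinked_integrable(2)[OF \<phi> sk]
  have Eint: "(E h has_integral (?f (\<theta> + h) - ?f \<theta> - ?D h)) {0..1}" for h
    unfolding E_def pint_def
    by (intro has_integral_diff has_integral_add has_integral_mult_right integrable_integral ints)
  have E: "?f (\<theta> + h) - ?f \<theta> - ?D h = integral {0..1} (E h)" for h
    by (rule integral_unique[OF Eint, symmetric])
  have alt: "E h s = (\<phi> ((\<theta> + h)$1 * s + (\<theta> + h)$2) - \<phi> (\<theta>$1 * s + \<theta>$2) -
      \<phi>' (\<theta>$1 * s + \<theta>$2) * (h$1 * s + h$2)) * k s" for h s
    by (simp add: E_def algebra_simps)
  have "((\<lambda>h. integral {0..1} (\<lambda>s. E h s / norm h)) \<longlongrightarrow> integral {0..1} (\<lambda>s::real. 0)) (at 0)"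
  proof (rule integral_tendsto_bounded[OF _ _ negligible_kink[OF nz], of "ball (0::real^3) 1"])
    fix h :: "real^3" assume h: "h \<in> ball 0 1"
    show "(\<lambda>s. E h s / norm h) integrable_on {0..1}"
      using has_integral_mult_left[OF Eint, of h "inverse (norm h)"]
      unfolding divide_inverse by (rule has_integral_integrable)
    fix s :: real assume s: "s \<in> {0..1}"
    have n: "\<bar>\<theta>$i\<bar> \<le> norm \<theta> + 1" "\<bar>(\<theta> + h)$i\<bar> \<le> norm \<theta> + 1" for i
      using component_le_norm_cart[of \<theta> i] component_le_norm_cart[of "\<theta> + h" i]
        norm_triangle_ineq[of \<theta> h] h by auto
    note y = affine_bound[OF n(1) n(1) s, of 1 2] affine_bound[OF n(2) n(2) s, of 1 2]
    have B0: "0 \<le> B" using B[OF y] by linarith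
    have eta: "\<bar>h$1 * s + h$2\<bar> \<le> 2 * norm h"
      using s by (intro affine_bound component_le_norm_cart)
    have "\<bar>\<phi> ((\<theta> + h)$1 * s + (\<theta> + h)$2) - \<phi> (\<theta>$1 * s + \<theta>$2)\<bar> \<le> B * \<bar>h$1 * s + h$2\<bar>"
      using B[OF y(2,1)] by (simp add: algebra_simps)
    moreover have "\<bar>\<phi>' (\<theta>$1 * s + \<theta>$2) * (h$1 * s + h$2)\<bar> \<le> B * \<bar>h$1 * s + h$2\<bar>"
      unfolding abs_mult using B[OF y] by (intro mult_right_mono) auto
    moreover have "B * \<bar>h$1 * s + h$2\<bar> \<le> B * (2 * norm h)"
      using eta B0 by (rule mult_left_mono)
    ultimately have "\<bar>\<phi> ((\<theta> + h)$1 * s + (\<theta> + h)$2) - \<phi> (\<theta>$1 * s + \<theta>$2) -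
      \<phi>' (\<theta>$1 * s + \<theta>$2) * (h$1 * s + h$2)\<bar> \<le> 4 * B * norm h" by linarith
    then have "\<bar>E h s\<bar> \<le> 4 * B * norm h * K"
      unfolding alt abs_mult using K[OF s] B0 by (intro mult_mono) auto
    \<comment> \<open>At \<open>h = 0\<close> the quotient is \<open>0\<close> by convention, so
      nonnegativity of the right-hand side suffices there.\<close>
    then show "\<bar>E h s / norm h\<bar> \<le> 4 * B * K"
      using mult_nonneg_nonneg[OF B0 order_trans[OF abs_ge_zero K[OF s]]]
      by (cases "h = 0") (simp_all add: divide_le_eq mult.assoc mult.commute[of K])
  next
    fix s assume "s \<in> {0..1} - {s. \<theta>$1 * s + \<theta>$2 = 0}"
    then have dphi: "(\<phi> has_real_derivative \<phi>' (\<theta>$1 * s + \<theta>$2)) (at (\<theta>$1 * s + \<theta>$2))"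
      using \<phi> unfolding kinked_def by blast
    have "((\<lambda>x. x$1 * s + x$2) has_derivative (\<lambda>h. h$1 * s + h$2)) (at \<theta>)"
      by (intro has_derivative_add has_derivative_mult_left bounded_linear_imp_has_derivative bounded_linear_vec_nth)
    then have "((\<lambda>x. \<phi> (x$1 * s + x$2)) has_derivative (\<lambda>h. (h$1 * s + h$2) * \<phi>' (\<theta>$1 * s + \<theta>$2))) (at \<theta>)"
      by (rule DERIV_compose_FDERIV[where f=\<phi> and g="\<lambda>x::real^3. x$1 * s + x$2" and x=\<theta>, OF dphi])
    then have "((\<lambda>h. norm (\<phi> ((\<theta> + h)$1 * s + (\<theta> + h)$2) - \<phi> (\<theta>$1 * s + \<theta>$2) -
        (h$1 * s + h$2) * \<phi>' (\<theta>$1 * s + \<theta>$2)) / norm h * \<bar>k s\<bar>) \<longlongrightarrow> 0) (at 0)"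
      unfolding has_derivative_at by (intro tendsto_mult_left_zero) (rule conjunct2)
    then show "((\<lambda>h. E h s / norm h) \<longlongrightarrow> 0) (at 0)"
      by (rule Lim_null_comparison[rotated]) (simp add: alt abs_mult mult.commute)
  qed auto
  then have "((\<lambda>h. norm (integral {0..1} (E h) / norm h)) \<longlongrightarrow> 0) (at 0)"
    by (intro tendsto_norm_zero) (simp add: divide_inverse)
  moreover have "bounded_linear ?D"
    by (intro bounded_linear_add bounded_linear_compose[OF bounded_linear_mult_left bounded_linear_vec_nth])
  ultimately show ?thesis unfolding has_derivative_at E by simp
qed

lemma pint_has_integral:
  assumes "kinked \<phi> \<phi>'" "continuous_on {0..1} k"
  shows "((\<lambda>s. \<phi> (w * s + b) * k s) has_integral pint \<phi> k w b) {0..1}"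
  unfolding pint_def using kinked_integrable(1)[OF assms] by (rule integrable_integral)

lemma pint_deriv_has_integral:
  assumes "kinked \<phi> \<phi>'" "continuous_on {0..1} k"
  shows "((\<lambda>s. \<phi>' (w * s + b) * k s) has_integral pint \<phi>' k w b) {0..1}"
  unfolding pint_def using kinked_integrable(2)[OF assms] by (rule integrable_integral)

text \<open>Pulling the factor \<open>w * s + b\<close> into the integral; for positively
  homogeneous \<open>\<phi>\<close> this is Euler's identity.\<close>

lemma pint_euler:
  assumes "kinked \<phi> \<phi>'" "continuous_on {0..1} k"
  shows "w * pint \<phi>' (\<lambda>s. s * k s) w b + b * pint \<phi>' k w b = pint (\<lambda>y. y * \<phi>' y) k w b"
proof -
  have "continuous_on {0..1} (\<lambda>s. s * k s)" using assms(2) by (intro continuous_intros)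
  from has_integral_add[OF has_integral_mult_right[OF pint_deriv_has_integral[OF assms(1) this], of w w b]
      has_integral_mult_right[OF pint_deriv_has_integral[OF assms], of b w b]]
  have "((\<lambda>s. (w * s + b) * \<phi>' (w * s + b) * k s) has_integral
      (w * pint \<phi>' (\<lambda>s. s * k s) w b + b * pint \<phi>' k w b)) {0..1}"
    by (simp add: algebra_simps)
  then show ?thesis unfolding pint_def by (simp add: integral_unique)
qed

lemma pint_uminus: "pint \<phi> (\<lambda>s. - k s) w b = - pint \<phi> k w b"
  by (simp add: pint_def)

text \<open>The substitution \<open>s \<mapsto> 1 - s\<close> exchanges the endpoints, so that a
  neuron active near \<open>1\<close> is treated as one active near \<open>0\<close>.\<close>

lemma pint_reflect: "pint \<phi> k w b = pint \<phi> (\<lambda>s. k (1 - s)) (- w) (w + b)"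
proof -
  have "integral {0..1} (\<lambda>s. \<phi> (w * s + b) * k s)
      = integral {0..1} (\<lambda>s. \<phi> (w * (1 - s) + b) * k (1 - s))"
  proof -
    define h where "h s = \<phi> (w * s + b) * k s" for s
    have "integral {0..1} h = integral {-1..-0} (\<lambda>s. h (- s))"
      by (rule Henstock_Kurzweil_Integration.integral_reflect_real[symmetric])
    also have "\<dots> = integral {0..1} (\<lambda>s. h (1 - s))"
      using integral_shift_Icc_real[of "-1" 0 "\<lambda>s. h (1 - s)" 1] by (simp add: comp_def)
    finally show ?thesis unfolding h_def .
  qed
  then show ?thesis by (simp add: pint_def algebra_simps)
qed

section \<open>The risk and its gradient\<close>

definition pmean :: "real \<Rightarrow> real \<Rightarrow> real" where
  "pmean = pint (\<lambda>y. max y 0) (\<lambda>_. 1)"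

definition psq :: "real \<Rightarrow> real \<Rightarrow> real" where
  "psq = pint (\<lambda>y. (max y 0)\<^sup>2) (\<lambda>_. 1)"

definition pvar :: "real \<Rightarrow> real \<Rightarrow> real" where
  "pvar w b = psq w b - (pmean w b)\<^sup>2"

definition pcorr :: "(real \<Rightarrow> real) \<Rightarrow> real \<Rightarrow> real \<Rightarrow> real" where
  "pcorr = pint (\<lambda>y. max y 0)"

text \<open>Partial derivatives of the risk with respect to \<open>\<theta>\<^sub>1\<close>, \<open>\<theta>\<^sub>2\<close>, \<open>\<theta>\<^sub>3\<close>, for the centred target \<open>F\<close>.\<close>

definition Lw :: "(real \<Rightarrow> real) \<Rightarrow> real \<Rightarrow> real \<Rightarrow> real \<Rightarrow> real" where
  "Lw F w b c = c\<^sup>2 * (pint (\<lambda>y. 2 * max y 0) (\<lambda>s. s) w b - 2 * pmean w b * pint step (\<lambda>s. s) w b)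
    - 2 * c * pint step (\<lambda>s. s * F s) w b"

definition Lb :: "(real \<Rightarrow> real) \<Rightarrow> real \<Rightarrow> real \<Rightarrow> real \<Rightarrow> real" where
  "Lb F w b c = c\<^sup>2 * (pint (\<lambda>y. 2 * max y 0) (\<lambda>_. 1) w b - 2 * pmean w b * pint step (\<lambda>_. 1) w b)
    - 2 * c * pint step F w b"

definition Lc :: "(real \<Rightarrow> real) \<Rightarrow> real \<Rightarrow> real \<Rightarrow> real \<Rightarrow> real" where
  "Lc F w b c = 2 * (c * pvar w b - pcorr F w b)"

text \<open>The risk is unchanged when the output weight and the target both change sign; this
  symmetry turns the upper bound for \<open>c\<close> into the lower one.\<close>

lemma partials_uminus:
  "Lw (\<lambda>s. - F s) w b (- c) = Lw F w b c"
  "Lb (\<lambda>s. - F s) w b (- c) = Lb F w b c"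
  "Lc (\<lambda>s. - F s) w b (- c) = - Lc F w b c"
  using pint_uminus[of step "\<lambda>s. s * F s" w b]
  by (simp_all add: Lw_def Lb_def Lc_def pcorr_def pint_uminus)

text \<open>Infinitesimal form of the invariance of the risk under
  \<open>(w, b, c) \<mapsto> (r w, r b, c / r)\<close> for \<open>r > 0\<close>, which comes from
  the homogeneity of the ReLU.\<close>

lemma partials_euler:
  assumes F: "continuous_on {0..1} F"
  shows "w * Lw F w b c + b * Lb F w b c = c * Lc F w b c"
proof -
  have 1: "w * pint (\<lambda>y. 2 * max y 0) (\<lambda>s. s) w b + b * pint (\<lambda>y. 2 * max y 0) (\<lambda>_. 1) w b = 2 * psq w b"
  proof -
    have "(\<lambda>y. y * (2 * max y 0)) = (\<lambda>y::real. 2 * (max y 0)\<^sup>2)"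
      by (auto simp: max_def power2_eq_square)
    then show ?thesis
      using pint_euler[OF kinked_relu_sq, of "\<lambda>_. 1" w b]
      by (simp add: psq_def pint_def)
  qed
  have y: "(\<lambda>y. y * step y) = (\<lambda>y. max y 0)" by (auto simp: step_def)
  have 2: "w * pint step (\<lambda>s. s) w b + b * pint step (\<lambda>_. 1) w b = pmean w b"
    using pint_euler[OF kinked_relu, of "\<lambda>_. 1" w b] by (simp add: pmean_def y)
  have 3: "w * pint step (\<lambda>s. s * F s) w b + b * pint step F w b = pcorr F w b"
    using pint_euler[OF kinked_relu F, of w b] by (simp add: pcorr_def y)
  have "w * Lw F w b c + b * Lb F w b c =
      c\<^sup>2 * ((w * pint (\<lambda>y. 2 * max y 0) (\<lambda>s. s) w b + b * pint (\<lambda>y. 2 * max y 0) (\<lambda>_. 1) w b)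
        - 2 * pmean w b * (w * pint step (\<lambda>s. s) w b + b * pint step (\<lambda>_. 1) w b))
      - 2 * c * (w * pint step (\<lambda>s. s * F s) w b + b * pint step F w b)"
    unfolding Lw_def Lb_def by (simp only: algebra_simps)
  also have "\<dots> = c * Lc F w b c"
    unfolding 1 2 3 Lc_def pvar_def by (simp add: power2_eq_square algebra_simps)
  finally show ?thesis .
qed

section \<open>The risk as a quadratic polynomial in the output weight\<close>

lemma risk_integral:
  assumes F: "continuous_on {0..1} F" "integral {0..1} F = 0"
  shows "integral {0..1} (\<lambda>s. (c * (max (w * s + b) 0 - pmean w b) - F s)\<^sup>2)
    = c\<^sup>2 * pvar w b - 2 * c * pcorr F w b + integral {0..1} (\<lambda>s. (F s)\<^sup>2)"
proof -
  let ?m = "pmean w b"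
  have F1: "(F has_integral 0) {0..1}"
    using F integrable_continuous_interval integrable_integral by metis
  have F2: "((\<lambda>s. (F s)\<^sup>2) has_integral integral {0..1} (\<lambda>s. (F s)\<^sup>2)) {0..1}"
    using F(1) by (intro integrable_integral integrable_continuous_interval continuous_intros)
  have 1: "((\<lambda>s. max (w * s + b) 0) has_integral ?m) {0..1}"
    using pint_has_integral[OF kinked_relu continuous_on_const, of w b 1] by (simp add: pmean_def)
  have 2: "((\<lambda>s. (max (w * s + b) 0)\<^sup>2) has_integral psq w b) {0..1}"
    using pint_has_integral[OF kinked_relu_sq continuous_on_const, of w b 1] by (simp add: psq_def)
  have 3: "((\<lambda>s. max (w * s + b) 0 * F s) has_integral pcorr F w b) {0..1}"
    using pint_has_integral[OF kinked_relu F(1), of w b] by (simp add: pcorr_def)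
  have 4: "((\<lambda>s::real. ?m\<^sup>2) has_integral ?m\<^sup>2) {0..1}"
    using has_integral_const_real[of "?m\<^sup>2" 0 1] by simp
  have "((\<lambda>s. c\<^sup>2 * ((max (w * s + b) 0)\<^sup>2 - (2 * ?m) * max (w * s + b) 0 + ?m\<^sup>2)
      - (2 * c) * (max (w * s + b) 0 * F s) + (2 * c * ?m) * F s + (F s)\<^sup>2) has_integral
      (c\<^sup>2 * (psq w b - (2 * ?m) * ?m + ?m\<^sup>2) - (2 * c) * pcorr F w b + (2 * c * ?m) * 0
      + integral {0..1} (\<lambda>s. (F s)\<^sup>2))) {0..1}" (is "(?g has_integral ?I) _")
    by (intro has_integral_add has_integral_diff has_integral_mult_right 1 2 3 4 F1 F2)
  moreover have "?g = (\<lambda>s. (c * (max (w * s + b) 0 - ?m) - F s)\<^sup>2)"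
    by (rule ext) (simp only: power2_eq_square algebra_simps)
  moreover have "?I = c\<^sup>2 * pvar w b - 2 * c * pcorr F w b + integral {0..1} (\<lambda>s. (F s)\<^sup>2)"
    unfolding pvar_def by (simp add: power2_eq_square algebra_simps)
  ultimately show ?thesis by (simp only: integral_unique)
qed

text \<open>By Young's inequality \<open>2 c A \<le> c\<^sup>2 V / 2 + 2 \<integral>F\<^sup>2\<close>: the risk with target \<open>2 F\<close> is nonnegative.\<close>

lemma output_variance_le:
  assumes F: "continuous_on {0..1} F" "integral {0..1} F = 0"
  shows "c\<^sup>2 * pvar w b \<le> 2 * (c\<^sup>2 * pvar w b - 2 * c * pcorr F w b) + 4 * integral {0..1} (\<lambda>s. (F s)\<^sup>2)"
proof -
  have "0 \<le> integral {0..1} (\<lambda>s. (c * (max (w * s + b) 0 - pmean w b) - 2 * F s)\<^sup>2)"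
    by (intro integral_nonneg integrable_continuous_interval continuous_intros F) auto
  also have "\<dots> = c\<^sup>2 * pvar w b - 2 * c * pcorr (\<lambda>s. 2 * F s) w b + integral {0..1} (\<lambda>s. (2 * F s)\<^sup>2)"
    using F by (intro risk_integral continuous_intros) simp_all
  also have "pcorr (\<lambda>s. 2 * F s) w b = 2 * pcorr F w b"
    unfolding pcorr_def pint_def by (simp add: mult.left_commute)
  finally show ?thesis by (simp add: power_mult_distrib mult.commute)
qed

section \<open>Inactive and fully active neurons\<close>

lemma pint_inactive:
  assumes "b \<le> 0" "w + b \<le> 0" "\<And>y. y \<le> 0 \<Longrightarrow> \<phi> y = 0"
  shows "pint \<phi> k w b = 0"
proof -
  have "w * s + b \<le> 0" if "s \<in> {0..1}" for s
    using convex_bound_le[of b 0 "w + b" "1 - s" s] assms(1,2) that by (simp add: algebra_simps)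
  then have "integral {0..1} (\<lambda>s. \<phi> (w * s + b) * k s) = integral {0..1} (\<lambda>s::real. 0)"
    using assms(3) by (intro integral_cong) auto
  then show ?thesis by (simp add: pint_def)
qed

lemma Lc_inactive:
  assumes "b \<le> 0" "w + b \<le> 0"
  shows "Lc F w b c = 0"
  using assms by (simp add: Lc_def pvar_def psq_def pmean_def pcorr_def pint_inactive)

text \<open>The neuron is affine on \<open>[0,1]\<close>, so a change of \<open>b\<close> only
  shifts its mean, which the risk subtracts.\<close>

lemma Lb_fully_active:
  assumes "b > 0" "w + b > 0" and F: "integral {0..1} F = 0"
  shows "Lb F w b c = 0"
proof -
  have pos: "w * s + b > 0" if "s \<in> {0..1}" for s
    using convex_bound_lt[of "- b" 0 "- (w + b)" "1 - s" s] assms(1,2) that by (simp add: algebra_simps)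
  have st: "pint step k w b = integral {0..1} k" for k
    unfolding pint_def using pos by (intro integral_cong) (auto simp: step_def)
  have "pint (\<lambda>y. 2 * max y 0) (\<lambda>_. 1) w b = 2 * pmean w b"
    by (simp add: pint_def pmean_def)
  then show ?thesis by (simp add: Lb_def st F)
qed

section \<open>Differentiability of the risk\<close>

lemma pmoments_has_derivative:
  fixes \<theta> :: "real^3"
  assumes nz: "\<theta>$1 \<noteq> 0 \<or> \<theta>$2 \<noteq> 0"
  shows "((\<lambda>\<theta>. psq (\<theta>$1) (\<theta>$2)) has_derivative (\<lambda>h.
      h$1 * pint (\<lambda>y. 2 * max y 0) (\<lambda>s. s) (\<theta>$1) (\<theta>$2) +
      h$2 * pint (\<lambda>y. 2 * max y 0) (\<lambda>_. 1) (\<theta>$1) (\<theta>$2))) (at \<theta>)"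
    "((\<lambda>\<theta>. pmean (\<theta>$1) (\<theta>$2)) has_derivative (\<lambda>h.
      h$1 * pint step (\<lambda>s. s) (\<theta>$1) (\<theta>$2) + h$2 * pint step (\<lambda>_. 1) (\<theta>$1) (\<theta>$2))) (at \<theta>)"
  using pint_has_derivative[OF kinked_relu_sq continuous_on_const nz, of 1]
    pint_has_derivative[OF kinked_relu continuous_on_const nz, of 1]
  by (simp_all add: psq_def pmean_def)

lemma pcorr_has_derivative:
  fixes \<theta> :: "real^3"
  assumes "continuous_on {0..1} F" "\<theta>$1 \<noteq> 0 \<or> \<theta>$2 \<noteq> 0"
  shows "((\<lambda>\<theta>. pcorr F (\<theta>$1) (\<theta>$2)) has_derivative (\<lambda>h.
      h$1 * pint step (\<lambda>s. s * F s) (\<theta>$1) (\<theta>$2) + h$2 * pint step F (\<theta>$1) (\<theta>$2))) (at \<theta>)"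
  unfolding pcorr_def by (rule pint_has_derivative[OF kinked_relu assms])

lemma integral_centred:
  assumes "continuous_on {0..1} f"
  shows "integral {0..1} (\<lambda>s. f s - fmean f) = 0"
proof -
  have "((\<lambda>s. f s - fmean f) has_integral fmean f - fmean f * 1) {0..1}"
    using has_integral_const_real[of "fmean f" 0 1] integrable_continuous_interval[OF assms]
    by (intro has_integral_diff) (simp_all add: fmean_def integrable_integral)
  then show ?thesis by (simp add: integral_unique)
qed

lemma risk_eq:
  assumes f: "continuous_on {0..1} f" and F: "F = (\<lambda>s. f s - fmean f)"
  shows "risk f \<theta> = (\<theta>$3)\<^sup>2 * (psq (\<theta>$1) (\<theta>$2) - (pmean (\<theta>$1) (\<theta>$2))\<^sup>2)
    - 2 * \<theta>$3 * pcorr F (\<theta>$1) (\<theta>$2) + integral {0..1} (\<lambda>s. (F s)\<^sup>2)"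
proof -
  have cF: "continuous_on {0..1} F" unfolding F using f by (intro continuous_intros)
  have iF: "integral {0..1} F = 0" unfolding F by (rule integral_centred[OF f])
  have "neuron_mean \<theta> = pmean (\<theta>$1) (\<theta>$2)"
    by (simp add: neuron_mean_def neuron_def pmean_def pint_def)
  then have "risk f \<theta> = integral {0..1}
      (\<lambda>s. (\<theta>$3 * (max (\<theta>$1 * s + \<theta>$2) 0 - pmean (\<theta>$1) (\<theta>$2)) - F s)\<^sup>2)"
    unfolding risk_def neuron_def F by (simp add: algebra_simps)
  with risk_integral[OF cF iF] show ?thesis by (simp add: pvar_def)
qed

lemma risk_gderiv:
  fixes \<theta> :: "real^3"
  assumes f: "continuous_on {0..1} f" and F: "F = (\<lambda>s. f s - fmean f)" and nz: "\<theta>$1 \<noteq> 0 \<or> \<theta>$2 \<noteq> 0"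
  shows "GDERIV (risk f) \<theta> :> vector [Lw F (\<theta>$1) (\<theta>$2) (\<theta>$3), Lb F (\<theta>$1) (\<theta>$2) (\<theta>$3), Lc F (\<theta>$1) (\<theta>$2) (\<theta>$3)]"
proof -
  have cF: "continuous_on {0..1} F" unfolding F using f by (intro continuous_intros)
  have d3: "((\<lambda>\<theta>::real^3. \<theta>$3) has_derivative (\<lambda>h. h$3)) (at \<theta>)"
    by (rule bounded_linear_imp_has_derivative[OF bounded_linear_vec_nth])
  note D = pmoments_has_derivative[OF nz] pcorr_has_derivative[OF cF nz] d3
  show ?thesis
    unfolding gderiv_def risk_eq[OF f F]
    by (rule has_derivative_eq_rhs, (rule has_derivative_add has_derivative_diff has_derivative_mult
        has_derivative_power has_derivative_const D)+)
      (simp add: fun_eq_iff inner_vec_def sum_3 Lw_def Lb_def Lc_def pvar_def power2_eq_square algebra_simps)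
qed

lemma partials_continuous:
  fixes \<theta> :: "real^3"
  assumes F: "continuous_on {0..1} F" and nz: "\<theta>$1 \<noteq> 0 \<or> \<theta>$2 \<noteq> 0"
  shows "isCont (\<lambda>\<theta>. Lw F (\<theta>$1) (\<theta>$2) (\<theta>$3)) \<theta>"
    "isCont (\<lambda>\<theta>. Lb F (\<theta>$1) (\<theta>$2) (\<theta>$3)) \<theta>"
    "isCont (\<lambda>\<theta>. Lc F (\<theta>$1) (\<theta>$2) (\<theta>$3)) \<theta>"
proof -
  have sF: "continuous_on {0..1} (\<lambda>s. s * F s)" using F by (intro continuous_intros)
  note c = continuous_pint_deriv[OF kinked_relu _ nz] continuous_pint_deriv[OF kinked_relu_sq _ nz]
    has_derivative_continuous[OF pmoments_has_derivative(1)[OF nz]]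
    has_derivative_continuous[OF pmoments_has_derivative(2)[OF nz]]
    has_derivative_continuous[OF pcorr_has_derivative[OF F nz]]
  show "isCont (\<lambda>\<theta>. Lw F (\<theta>$1) (\<theta>$2) (\<theta>$3)) \<theta>"
    "isCont (\<lambda>\<theta>. Lb F (\<theta>$1) (\<theta>$2) (\<theta>$3)) \<theta>"
    "isCont (\<lambda>\<theta>. Lc F (\<theta>$1) (\<theta>$2) (\<theta>$3)) \<theta>"
    unfolding Lw_def Lb_def Lc_def pvar_def by (intro continuous_intros c F sF)+
qed

text \<open>Compactness: the variance is continuous and positive on the part \<open>K\<close> of the
  circle that violates the conclusion, hence bounded away from \<open>0\<close> there.\<close>

lemma pvar_pos_away:
  assumes "0 < d"
  shows "\<exists>\<eta>>0. \<forall>w b. w\<^sup>2 + b\<^sup>2 = 1 \<longrightarrow> pvar w b \<le> \<eta> \<longrightarrow> 4 / 5 < b \<or> (b < d \<and> w + b < d)"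
proof -
  \<comment> \<open>The third coordinate is pinned to \<open>0\<close> because the continuity lemmas
    live on \<open>real^3\<close>, where \<open>K\<close> has to be compact.\<close>
  define K where "K = {\<theta>::real^3. (\<theta>$1)\<^sup>2 + (\<theta>$2)\<^sup>2 = 1 \<and> \<theta>$3 = 0 \<and> \<theta>$2 \<le> 4 / 5 \<and> (d \<le> \<theta>$2 \<or> d \<le> \<theta>$1 + \<theta>$2)}"
  have "closed K"
    unfolding K_def by (intro closed_Collect_conj closed_Collect_disj closed_Collect_eq closed_Collect_le continuous_intros)
  moreover have "bounded K"
    unfolding bounded_iff
  proof (intro exI ballI)
    fix \<theta> assume "\<theta> \<in> K"
    then show "norm \<theta> \<le> 1" by (simp add: K_def norm_vec_def L2_set_def sum_3)
  qed
  ultimately have K: "compact K" by (simp add: compact_eq_bounded_closed)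
  have pos: "pvar (\<theta>$1) (\<theta>$2) > 0" if \<theta>: "\<theta> \<in> K" for \<theta>
  proof -
    define g where "g s = (max (\<theta>$1 * s + \<theta>$2) 0 - pmean (\<theta>$1) (\<theta>$2))\<^sup>2" for s
    have g: "continuous_on {0..1} g" unfolding g_def by (intro continuous_intros)
    have int: "integral {0..1} g = pvar (\<theta>$1) (\<theta>$2)"
      using risk_integral[of "\<lambda>_. 0" 1 "\<theta>$1" "\<theta>$2"] by (simp add: g_def[abs_def] pcorr_def pint_def)
    have "integral {0..1} g \<noteq> 0"
    proof
      assume "integral {0..1} g = 0"
      then have "\<forall>s\<in>{0..1}. g s = 0"
        using integral_eq_0_iff[OF g] by (simp add: g_def)
      then have "g 0 = 0" "g 1 = 0" by auto
      \<comment> \<open>A neuron of zero variance has equal values at both endpoints. One of them is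
        at least \<open>d > 0\<close>, so \<open>w = 0\<close> and \<open>b = 1\<close>, against
        \<open>b \<le> 4 / 5\<close>.\<close>
      then have "max (\<theta>$2) 0 = max (\<theta>$1 + \<theta>$2) 0" by (simp add: g_def)
      with \<theta> \<open>0 < d\<close> have "\<theta>$1 = 0" "\<theta>$2 > 0" by (auto simp: K_def max_def split: if_splits)
      with \<theta> show False by (auto simp: K_def power2_eq_1_iff)
    qed
    moreover have "integral {0..1} g \<ge> 0"
      by (intro integral_nonneg integrable_continuous_interval g) (simp add: g_def)
    ultimately show ?thesis using int by simp
  qed
  have cont: "continuous_on K (\<lambda>\<theta>. pvar (\<theta>$1) (\<theta>$2))"
    unfolding pvar_def
  proof (intro continuous_at_imp_continuous_on ballI continuous_intros)
    fix \<theta> assume "\<theta> \<in> K"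
    then have nz: "\<theta>$1 \<noteq> 0 \<or> \<theta>$2 \<noteq> 0" by (auto simp: K_def)
    show "isCont (\<lambda>\<theta>. psq (\<theta>$1) (\<theta>$2)) \<theta>" "isCont (\<lambda>\<theta>. pmean (\<theta>$1) (\<theta>$2)) \<theta>"
      using pmoments_has_derivative[OF nz] by (auto dest: has_derivative_continuous)
  qed
  obtain \<eta> where \<eta>: "\<eta> > 0" "\<And>\<theta>. \<theta> \<in> K \<Longrightarrow> \<eta> < pvar (\<theta>$1) (\<theta>$2)"
  proof (cases "K = {}")
    case True then show ?thesis using that[of 1] by simp
  next
    case False
    then obtain z where z: "z \<in> K" "\<forall>\<theta>\<in>K. pvar (z$1) (z$2) \<le> pvar (\<theta>$1) (\<theta>$2)"
      using continuous_attains_inf[OF K _ cont] by blast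
    show ?thesis
    proof (rule that)
      show "pvar (z$1) (z$2) / 2 > 0" using pos[OF z(1)] by simp
      show "pvar (z$1) (z$2) / 2 < pvar (\<theta>$1) (\<theta>$2)" if "\<theta> \<in> K" for \<theta>
        using z(2) that pos[OF z(1)] by fastforce
    qed
  qed
  show ?thesis
  proof (intro exI[of _ \<eta>] conjI allI impI \<eta>(1))
    fix w b :: real assume "w\<^sup>2 + b\<^sup>2 = 1" "pvar w b \<le> \<eta>"
    moreover from this have "vector [w, b, 0] \<notin> K" using \<eta>(2)[of "vector [w, b, 0]"] by auto
    ultimately show "4 / 5 < b \<or> (b < d \<and> w + b < d)" by (auto simp: K_def)
  qed
qed

section \<open>Neurons active near one endpoint\<close>

lemma has_integral_norm_le:
  fixes f :: "real \<Rightarrow> real"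
  assumes "(f has_integral i) S" "(g has_integral j) S" "\<And>x. x \<in> S \<Longrightarrow> norm (f x) \<le> g x"
  shows "norm i \<le> j"
  using integral_norm_bound_integral[of f S g] assms by (auto simp: has_integral_iff)

lemma pint_end:
  assumes a: "0 < a" "0 < d" "d \<le> a" and \<phi>: "\<And>y. y \<le> 0 \<Longrightarrow> \<phi> y = 0"
  shows "pint \<phi> k (- a) d = integral {0..d / a} (\<lambda>s. \<phi> (d - a * s) * k s)"
proof -
  have sub: "{0..d / a} \<subseteq> {0..1}" using a by auto
  from integral_restrict_Int[of "{0..1}" "{0..d / a}" "\<lambda>s. \<phi> (d - a * s) * k s"]
  have "integral {0..d / a} (\<lambda>s. \<phi> (d - a * s) * k s) =
      integral {0..1} (\<lambda>s. if s \<in> {0..d / a} then \<phi> (d - a * s) * k s else 0)"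
    unfolding Int_absorb2[OF sub] by (rule sym)
  also have "\<dots> = pint \<phi> k (- a) d"
    unfolding pint_def using a \<phi> by (intro integral_cong) (auto simp: field_simps)
  finally show ?thesis by simp
qed

text \<open>The neuron is \<open>d - a * s\<close> on its support \<open>[0,l]\<close> and
  \<open>0\<close> beyond, so its moments have explicit antiderivatives. In the integrals with
  \<open>F\<close> the target is frozen at \<open>F 0\<close>; the Lipschitz error
  \<open>\<Lambda> * s\<close> is integrated explicitly as well.\<close>

lemma end_integrals:
  fixes a d \<Lambda> :: real
  defines "l \<equiv> d / a"
  assumes a: "0 < a" "0 < d" "d \<le> a" and F: "continuous_on {0..1} F"
    and lip: "\<And>s. s \<in> {0..1} \<Longrightarrow> \<bar>F s - F 0\<bar> \<le> \<Lambda> * s"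
  shows "pmean (- a) d = d * l / 2" "psq (- a) d = d\<^sup>2 * l / 3" "pint step (\<lambda>_. 1) (- a) d = l"
    "\<bar>pcorr F (- a) d - F 0 * d * l / 2\<bar> \<le> \<Lambda> * d * l\<^sup>2 / 6"
    "\<bar>pint step F (- a) d - F 0 * l\<bar> \<le> \<Lambda> * l\<^sup>2 / 2"
proof -
  have al: "a * l = d" and l: "0 < l" "l \<le> 1" using a by (auto simp: l_def)
  have sub: "{0..l} \<subseteq> {0..1}" using l by auto
  have cF: "continuous_on {0..l} F" using F sub by (rule continuous_on_subset)
  have pos: "0 \<le> d - a * s" if "s \<in> {0..l}" for s
    using that a mult_left_mono[of s l a] al by simp
  have relu: "pint \<phi> k (- a) d = integral {0..l} (\<lambda>s. \<psi> (d - a * s) * k s)"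
    if "\<And>y. y \<le> 0 \<Longrightarrow> \<phi> y = 0" "\<And>y. 0 \<le> y \<Longrightarrow> \<phi> y = \<psi> y" for \<phi> \<psi> k
  proof -
    have "pint \<phi> k (- a) d = integral {0..l} (\<lambda>s. \<phi> (d - a * s) * k s)"
      unfolding l_def by (rule pint_end[OF a that(1)])
    also have "\<dots> = integral {0..l} (\<lambda>s. \<psi> (d - a * s) * k s)"
      using pos that(2) by (intro integral_cong) auto
    finally show ?thesis .
  qed
  have step: "pint step k (- a) d = integral {0..l} k" for k
  proof -
    have "pint step k (- a) d = integral {0..l} (\<lambda>s. step (d - a * s) * k s)"
      unfolding l_def by (rule pint_end[OF a]) (simp add: step_def)
    \<comment> \<open>On the support the step function differs from \<open>1\<close> only at the
      right end \<open>l\<close>.\<close>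
    also have "\<dots> = integral {0..l} k"
    proof (rule integral_spike[of "{l}"])
      fix s assume s: "s \<in> {0..l} - {l}"
      then have "a * s < a * l" using a by auto
      then show "k s = step (d - a * s) * k s" by (simp add: al step_def)
    qed simp
    finally show ?thesis .
  qed
  have I: "(g' has_integral g l - g 0) {0..l}"
    if "\<And>s. (g has_real_derivative g' s) (at s)" for g g'
    using that l(1) by (intro fundamental_theorem_of_calculus)
      (auto simp: has_real_derivative_iff_has_vector_derivative[symmetric] intro: DERIV_subset)
  have I1: "((\<lambda>s. d - a * s) has_integral d * l / 2) {0..l}"
  proof -
    have "((\<lambda>s. d - a * s) has_integral (d * l - a * l\<^sup>2 / 2) - (d * 0 - a * 0\<^sup>2 / 2)) {0..l}"
      by (rule I[of "\<lambda>s. d * s - a * s\<^sup>2 / 2"]) (auto intro!: derivative_eq_intros)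
    moreover have "(d * l - a * l\<^sup>2 / 2) - (d * 0 - a * 0\<^sup>2 / 2) = d * l / 2"
      unfolding al[symmetric] by (simp add: power2_eq_square)
    ultimately show ?thesis by (simp only:)
  qed
  have I2: "((\<lambda>s. (d - a * s)\<^sup>2) has_integral d\<^sup>2 * l / 3) {0..l}"
  proof -
    have "((\<lambda>s. (d - a * s)\<^sup>2) has_integral (d\<^sup>2 * l - d * a * l\<^sup>2 + a\<^sup>2 * l ^ 3 / 3)
        - (d\<^sup>2 * 0 - d * a * 0\<^sup>2 + a\<^sup>2 * 0 ^ 3 / 3)) {0..l}"
      by (rule I[of "\<lambda>s. d\<^sup>2 * s - d * a * s\<^sup>2 + a\<^sup>2 * s ^ 3 / 3"])
        (auto intro!: derivative_eq_intros simp: power2_eq_square algebra_simps)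
    moreover have "(d\<^sup>2 * l - d * a * l\<^sup>2 + a\<^sup>2 * l ^ 3 / 3)
        - (d\<^sup>2 * 0 - d * a * 0\<^sup>2 + a\<^sup>2 * 0 ^ 3 / 3) = d\<^sup>2 * l / 3"
      unfolding al[symmetric] by (simp add: power2_eq_square power3_eq_cube)
    ultimately show ?thesis by (simp only:)
  qed
  have I3: "((\<lambda>s. (d - a * s) * (\<Lambda> * s)) has_integral \<Lambda> * d * l\<^sup>2 / 6) {0..l}"
  proof -
    have "((\<lambda>s. (d - a * s) * (\<Lambda> * s)) has_integral \<Lambda> * (d * l\<^sup>2 / 2 - a * l ^ 3 / 3)
        - \<Lambda> * (d * 0\<^sup>2 / 2 - a * 0 ^ 3 / 3)) {0..l}"
      by (rule I[of "\<lambda>s. \<Lambda> * (d * s\<^sup>2 / 2 - a * s ^ 3 / 3)"])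
        (auto intro!: derivative_eq_intros simp: power2_eq_square algebra_simps)
    moreover have "\<Lambda> * (d * l\<^sup>2 / 2 - a * l ^ 3 / 3) - \<Lambda> * (d * 0\<^sup>2 / 2 - a * 0 ^ 3 / 3) = \<Lambda> * d * l\<^sup>2 / 6"
      unfolding al[symmetric] by (simp add: power2_eq_square power3_eq_cube algebra_simps)
    ultimately show ?thesis by (simp only:)
  qed
  have I4: "((\<lambda>s. \<Lambda> * s) has_integral \<Lambda> * l\<^sup>2 / 2) {0..l}"
  proof -
    have "((\<lambda>s. \<Lambda> * s) has_integral \<Lambda> * l\<^sup>2 / 2 - \<Lambda> * 0\<^sup>2 / 2) {0..l}"
      by (rule I[of "\<lambda>s. \<Lambda> * s\<^sup>2 / 2"]) (auto intro!: derivative_eq_intros)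
    then show ?thesis by simp
  qed
  show "pmean (- a) d = d * l / 2"
    using relu[of "\<lambda>y. max y 0" "\<lambda>y. y" "\<lambda>_. 1"] I1 by (simp add: pmean_def integral_unique)
  show "psq (- a) d = d\<^sup>2 * l / 3"
    using relu[of "\<lambda>y. (max y 0)\<^sup>2" "\<lambda>y. y\<^sup>2" "\<lambda>_. 1"] I2 by (simp add: psq_def integral_unique)
  show "pint step (\<lambda>_. 1) (- a) d = l" using l by (simp add: step)
  have A: "((\<lambda>s. (d - a * s) * F s) has_integral pcorr F (- a) d) {0..l}"
    using relu[of "\<lambda>y. max y 0" "\<lambda>y. y" F] cF
    by (auto simp: pcorr_def intro!: integrable_integral integrable_continuous_interval continuous_intros)
  have "((\<lambda>s. (d - a * s) * F s - (d - a * s) * F 0) has_integral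
      (pcorr F (- a) d - (d * l / 2) * F 0)) {0..l}"
    by (intro has_integral_diff has_integral_mult_left A I1)
  then have "norm (pcorr F (- a) d - (d * l / 2) * F 0) \<le> \<Lambda> * d * l\<^sup>2 / 6"
  proof (rule has_integral_norm_le[OF _ I3])
    fix s assume "s \<in> {0..l}"
    then show "norm ((d - a * s) * F s - (d - a * s) * F 0) \<le> (d - a * s) * (\<Lambda> * s)"
      using lip[of s] pos[of s] sub
      by (auto simp: right_diff_distrib[symmetric] abs_mult intro!: mult_left_mono)
  qed
  then show "\<bar>pcorr F (- a) d - F 0 * d * l / 2\<bar> \<le> \<Lambda> * d * l\<^sup>2 / 6" by (simp add: mult.commute mult.left_commute)
  have S: "(F has_integral pint step F (- a) d) {0..l}"
    unfolding step by (intro integrable_integral integrable_continuous_interval cF)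
  have "((\<lambda>s. F s - F 0) has_integral (pint step F (- a) d - F 0 * l)) {0..l}"
    using has_integral_diff[OF S has_integral_const_real[of "F 0" 0 l]] l by (simp add: mult.commute)
  then have "norm (pint step F (- a) d - F 0 * l) \<le> \<Lambda> * l\<^sup>2 / 2"
  proof (rule has_integral_norm_le[OF _ I4])
    show "norm (F s - F 0) \<le> \<Lambda> * s" if "s \<in> {0..l}" for s using that lip[of s] sub by auto
  qed
  then show "\<bar>pint step F (- a) d - F 0 * l\<bar> \<le> \<Lambda> * l\<^sup>2 / 2" by simp
qed

section \<open>Drift of the output weight near an inactive neuron\<close>

text \<open>
  Here \<open>d\<close> is the value of the neuron at the active endpoint, \<open>- a\<close> its slope towards the interior, \<open>l\<close> the length of
  its support, \<open>k\<close> the value of \<open>F\<close> at the endpoint, \<open>S\<close> the integral of \<open>F\<close> over the support, and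
  \<open>2 c I\<close> the partial derivative of the risk in \<open>b\<close>. The ratio \<open>e\<close> is \<open>1\<close> at the endpoint \<open>0\<close> and
  \<open>(w - b) / w\<close> at the endpoint \<open>1\<close>. The left-hand side of the last inequality is the derivative of
  \<open>c + (max (X - (c d)\<^sup>2) 0)\<^sup>2\<close> along the flow, where \<open>X = (9 / 5 * max k 0)\<^sup>2\<close>.
\<close>

definition end_drift_bound :: "real \<Rightarrow> real \<Rightarrow> real \<Rightarrow> real \<Rightarrow> bool" where
  "end_drift_bound k \<Lambda> R \<delta> \<longleftrightarrow> (\<forall>c a d e b A S V I cdot ddot l.
    R \<le> c \<longrightarrow> 0 < d \<longrightarrow> d \<le> \<delta> \<longrightarrow> 1 / 2 \<le> a \<longrightarrow> a \<le> 1 \<longrightarrow>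
    l = d / a \<longrightarrow> 1 \<le> e \<longrightarrow> \<bar>b\<bar> \<le> 1 \<longrightarrow> \<bar>A - k * d * l / 2\<bar> \<le> \<Lambda> * d * l\<^sup>2 / 6 \<longrightarrow> \<bar>S - k * l\<bar> \<le> \<Lambda> * l\<^sup>2 / 2 \<longrightarrow>
    V = d\<^sup>2 * l / 3 - (d * l / 2)\<^sup>2 \<longrightarrow> I = c * (d * l / 2) * (1 - l) - S \<longrightarrow>
    cdot = 2 * (A - c * V) \<longrightarrow> ddot = - (c * e) * (b * cdot + 2 * I) \<longrightarrow>
    cdot - 4 * max ((9 / 5 * max k 0)\<^sup>2 - (c * d)\<^sup>2) 0 * (c * d) * (cdot * d + c * ddot) \<le> 0)"

text \<open>The size of \<open>x = c d\<close> decides. For \<open>x\<close> at least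
  \<open>9 / 5 * max k 0\<close> the cut-off term vanishes and \<open>c\<close> does not grow. Below
  that value \<open>x\<close> increases, so the cut-off term only helps; if \<open>c\<close> grows,
  then \<open>x < 8 / 5 * k\<close>, and the cut-off is steep enough to outweigh the growth.\<close>

lemma end_drift:
  fixes k \<Lambda> :: real
  assumes L: "0 \<le> \<Lambda>"
  shows "\<exists>R>0. \<exists>\<delta>>0. end_drift_bound k \<Lambda> R \<delta>"
proof -
  define K1 where "K1 = 2 * max k 0 + \<Lambda>"
  \<comment> \<open>\<open>32 * \<Lambda> \<le> c\<close> gives
    \<open>\<Lambda> * l \<le> x / 16\<close>, and \<open>8 / k\<^sup>2 \<le> c\<close> lets the
    cut-off term win at the end. The summand with \<open>k\<close> is \<open>0\<close> for
    \<open>k = 0\<close> by convention.\<close>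
  define R where "R = 32 * \<Lambda> + 1 + 8 / k\<^sup>2"
  \<comment> \<open>The bound \<open>1 / 48\<close> yields \<open>l \<le> 1 / 24\<close>. The other
    one makes \<open>d * (2 * \<Lambda> + K1)\<close>, the total error in the growth rate of
    \<open>d\<close>, at most \<open>k / 10\<close>.\<close>
  define d0 where "d0 = (if k > 0 then min (1 / 48) (k / (10 * (2 * \<Lambda> + K1))) else 1 / 48)"
  have R: "R \<ge> 1" using L by (simp add: R_def)
  have "k / (10 * (2 * \<Lambda> + K1)) > 0" if "k > 0" using that L by (simp add: K1_def)
  then have d0: "d0 > 0" "d0 \<le> 1 / 48"
    using min.cobounded1[of "1 / 48" "k / (10 * (2 * \<Lambda> + K1))"] unfolding d0_def by (auto simp only: split: if_splits) simp_all
  have "cdot - 4 * max ((9 / 5 * max k 0)\<^sup>2 - (c * d)\<^sup>2) 0 * (c * d) * (cdot * d + c * ddot) \<le> 0"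
    if c: "R \<le> c" and d: "0 < d" "d \<le> d0" and a: "1 / 2 \<le> a" "a \<le> 1" and l: "l = d / a"
      and e: "1 \<le> e" and b: "\<bar>b\<bar> \<le> 1"
      and A: "\<bar>A - k * d * l / 2\<bar> \<le> \<Lambda> * d * l\<^sup>2 / 6" and S: "\<bar>S - k * l\<bar> \<le> \<Lambda> * l\<^sup>2 / 2"
      and V: "V = d\<^sup>2 * l / 3 - (d * l / 2)\<^sup>2" and I: "I = c * (d * l / 2) * (1 - l) - S"
      and cdot: "cdot = 2 * (A - c * V)" and ddot: "ddot = - (c * e) * (b * cdot + 2 * I)"
    for c a d e b A S V I cdot ddot l
  proof -
    define x where "x = c * d"
    have c1: "c \<ge> 1" using c R by simp
    have "8 / k\<^sup>2 \<ge> 0" by simp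
    then have cR: "32 * \<Lambda> \<le> c" "8 / k\<^sup>2 \<le> c" using c L unfolding R_def by linarith+
    have A': "A \<le> k * d * l / 2 + \<Lambda> * d * l\<^sup>2 / 6" "k * d * l / 2 - \<Lambda> * d * l\<^sup>2 / 6 \<le> A"
      and S': "k * l - \<Lambda> * l\<^sup>2 / 2 \<le> S" using A S by linarith+
    have x: "x > 0" using c1 d by (simp add: x_def)
    have l0: "l > 0" using a d l by simp
    have l2: "l \<le> 2 * d"
    proof -
      have "d \<le> d * (2 * a)" using a d by simp
      then show ?thesis using a by (simp add: l field_simps)
    qed
    have l1: "l \<le> 1 / 24" using l2 d d0 by simp
    have dl: "d * l > 0" using d l0 by simp
    have Ll: "\<Lambda> * l \<le> x / 16"
    proof -
      have "\<Lambda> * l \<le> \<Lambda> * (2 * d)" using l2 L by (rule mult_left_mono)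
      also have "\<dots> \<le> (c / 32) * (2 * d)" using d cR by (intro mult_right_mono) auto
      finally show ?thesis by (simp add: x_def)
    qed
    \<comment> \<open>The leading coefficient \<open>- 2 / 3\<close> of \<open>x\<close> loses
      \<open>1 / 48\<close> to the Lipschitz error and \<open>1 / 48\<close> to the squared mean,
      leaving \<open>- 5 / 8\<close>. Hence \<open>c\<close> can grow only if
      \<open>x < 8 / 5 * k\<close>.\<close>
    have up: "cdot \<le> d * l * (k - 5 / 8 * x)"
    proof -
      have "cdot \<le> d * l * (k + \<Lambda> * l / 3 - 2 / 3 * x + x * l / 2)"
        using A'(1) unfolding cdot V x_def by (simp add: power2_eq_square algebra_simps)
      also have "\<dots> \<le> d * l * (k - 5 / 8 * x)"
      proof (intro mult_left_mono)
        have "x * l \<le> x * (1 / 24)" using l1 x by (intro mult_left_mono) auto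
        then show "k + \<Lambda> * l / 3 - 2 / 3 * x + x * l / 2 \<le> k - 5 / 8 * x" using Ll by linarith
      qed (use dl in simp)
      finally show ?thesis .
    qed
    have low: "cdot \<ge> d * l * (k - \<Lambda> * l / 3 - 2 / 3 * x)"
    proof -
      have "c * V \<le> c * (d\<^sup>2 * l / 3)" using c1 by (intro mult_left_mono) (auto simp: V)
      then show ?thesis using A'(2) unfolding cdot x_def
        by (simp add: power2_eq_square algebra_simps)
    qed
    show ?thesis
    proof (cases "x\<^sup>2 < (9 / 5 * max k 0)\<^sup>2")
      case False
      then have "9 / 5 * max k 0 \<le> x" using x by (simp add: not_less power2_le_iff_abs_le abs_le_square_iff[symmetric])
      then have "k - 5 / 8 * x \<le> 0" using x by (simp add: max_def split: if_splits)
      then have "d * l * (k - 5 / 8 * x) \<le> 0" using dl by (intro mult_nonneg_nonpos) auto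
      then show ?thesis using False up unfolding x_def by (simp add: max_def)
    next
      case True
      then have xk: "x < 9 / 5 * max k 0" using x power2_less_imp_less by fastforce
      then have k: "k > 0" using x by (simp add: max_def split: if_splits)
      then have xk: "x < 9 / 5 * k" and K1: "K1 = 2 * k + \<Lambda>" using xk by (auto simp: K1_def)
      have dK: "d * (2 * \<Lambda> + K1) \<le> k / 10"
      proof -
        have "2 * \<Lambda> + K1 > 0" using k L by (simp add: K1)
        moreover have "d \<le> k / (10 * (2 * \<Lambda> + K1))" using d k by (simp add: d0_def)
        ultimately show ?thesis by (simp add: field_simps)
      qed
      have abs: "\<bar>cdot\<bar> \<le> d * l * K1"
      proof -
        have "\<Lambda> * l \<le> \<Lambda> * 1" using l1 L by (intro mult_left_mono) auto
        then have "d * l * (- K1) \<le> d * l * (k - \<Lambda> * l / 3 - 2 / 3 * x)"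
          using dl xk L k by (intro mult_left_mono) (auto simp: K1)
        moreover have "d * l * (k - 5 / 8 * x) \<le> d * l * K1"
          using dl x L k by (intro mult_left_mono) (auto simp: K1)
        ultimately show ?thesis using up low by linarith
      qed
      \<comment> \<open>Since \<open>x < 9 / 5 * k\<close>, the leading term
        \<open>2 * k - x\<close> exceeds \<open>k / 5\<close>; the errors consume at most
        \<open>k / 10\<close> of it.\<close>
      have "- (b * cdot + 2 * I) \<ge> l * (k / 10)"
      proof -
        have "\<bar>b * cdot\<bar> \<le> 1 * (d * l * K1)" unfolding abs_mult using b abs by (intro mult_mono) auto
        moreover have "- (2 * I) \<ge> l * (2 * k - x - \<Lambda> * l)"
        proof -
          have "- (2 * I) = 2 * S - x * l + x * l * l" unfolding I x_def by (simp add: field_simps)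
          moreover have "x * l * l \<ge> 0" using x l0 by simp
          moreover have "2 * S \<ge> l * (2 * k - \<Lambda> * l)"
            using S' by (simp add: power2_eq_square algebra_simps)
          ultimately show ?thesis by (simp add: algebra_simps)
        qed
        moreover have "l * (2 * k - x - \<Lambda> * l) - d * l * K1 \<ge> l * (k / 10)"
        proof -
          have "\<Lambda> * l \<le> \<Lambda> * (2 * d)" using l2 L by (rule mult_left_mono)
          then have "k / 10 \<le> 2 * k - x - \<Lambda> * l - d * K1" using xk dK by (simp add: algebra_simps)
          then have "l * (k / 10) \<le> l * (2 * k - x - \<Lambda> * l - d * K1)" using l0 by (intro mult_left_mono) auto
          then show ?thesis by (simp add: algebra_simps)
        qed
        ultimately show ?thesis by linarith
      qed
      then have "c * e * (l * (k / 10)) \<le> c * e * (- (b * cdot + 2 * I))"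
        using c1 e by (intro mult_left_mono) auto
      moreover have "c * 1 * (l * (k / 10)) \<le> c * e * (l * (k / 10))"
        using c1 e l0 k by (intro mult_right_mono mult_left_mono) auto
      ultimately have "ddot \<ge> c * l * k / 10" unfolding ddot by (simp add: algebra_simps)
      then have "c * (c * l * k / 10) \<le> c * ddot" using c1 by (intro mult_left_mono) auto
      \<comment> \<open>In the derivative of \<open>c d\<close> a possible decrease of
        \<open>c\<close> costs at most half of the gain from \<open>ddot\<close>.\<close>
      moreover have "- (cdot * d) \<le> c * (c * l * k / 20)"
      proof -
        have "(- cdot) * d \<le> (d * l * K1) * d" using abs d by (intro mult_right_mono) auto
        then have "- (cdot * d) \<le> (d * l * K1) * d" by simp
        also have "\<dots> = (d * K1) * (l * d)" by simp
        also have "\<dots> \<le> (k / 10) * (l * (1 / 2))"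
        proof (intro mult_mono)
          have "d * K1 \<le> d * (2 * \<Lambda> + K1)" using d L by (intro mult_left_mono) auto
          then show "d * K1 \<le> k / 10" using dK by simp
        qed (use d d0 l0 k in auto)
        also have "\<dots> \<le> (c * c) * (l * k / 20)"
        proof -
          have "1 * (l * k / 20) \<le> (c * c) * (l * k / 20)"
            using c1 l0 k mult_mono[of 1 c 1 c] by (intro mult_right_mono) auto
          then show ?thesis by (simp add: mult.commute[of k])
        qed
        finally show ?thesis by (simp add: mult_ac)
      qed
      ultimately have xd: "cdot * d + c * ddot \<ge> c\<^sup>2 * l * k / 20"
        by (simp add: power2_eq_square algebra_simps)
      have xd0: "c\<^sup>2 * l * k / 20 > 0" using c1 l0 k by simp
      define P where "P = 4 * max ((9 / 5 * max k 0)\<^sup>2 - (c * d)\<^sup>2) 0 * (c * d)"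
      have P0: "P \<ge> 0" using x by (simp add: P_def x_def)
      show ?thesis
      proof (cases "cdot \<le> 0")
        case True
        have "P * (cdot * d + c * ddot) \<ge> 0" using P0 xd xd0 by (intro mult_nonneg_nonneg) auto
        then show ?thesis using True unfolding P_def by linarith
      next
        case False
        then have "0 < d * l * (k - 5 / 8 * x)" using up by linarith
        then have "x < 8 / 5 * k" using dl zero_less_mult_pos by fastforce
        then have "x\<^sup>2 \<le> (8 / 5 * k)\<^sup>2" using x by (intro power_mono) auto
        \<comment> \<open>The gap between the thresholds:
          \<open>(9 / 5)\<^sup>2 - (8 / 5)\<^sup>2 = 17 / 25\<close>.\<close>
        then have "(9 / 5 * max k 0)\<^sup>2 - (c * d)\<^sup>2 \<ge> 17 / 25 * k\<^sup>2"
          using k unfolding x_def[symmetric] by (simp add: power_mult_distrib power_divide)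
        then have "17 / 25 * k\<^sup>2 \<le> max ((9 / 5 * max k 0)\<^sup>2 - (c * d)\<^sup>2) 0"
          by (rule max.coboundedI1)
        then have "P \<ge> 4 * (17 / 25 * k\<^sup>2) * x"
          unfolding P_def x_def[symmetric] using x by (intro mult_right_mono mult_left_mono) auto
        then have "P * (cdot * d + c * ddot) \<ge> (4 * (17 / 25 * k\<^sup>2) * x) * (c\<^sup>2 * l * k / 20)"
          using xd xd0 x P0 by (intro mult_mono) auto
        \<comment> \<open>The left-hand side is \<open>17 / 125 * c ^ 3 * k\<^sup>2\<close> times
          the right-hand side, so \<open>c ^ 3 * k\<^sup>2 \<ge> 8\<close> is enough.\<close>
        moreover have "(4 * (17 / 25 * k\<^sup>2) * x) * (c\<^sup>2 * l * k / 20) \<ge> d * l * k"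
        proof -
          note cR(2)
          also have "c \<le> c ^ 3" using c1 by (intro self_le_power) auto
          finally have "8 \<le> c ^ 3 * k\<^sup>2" using k by (simp add: divide_le_eq)
          then have "1 \<le> 17 / 125 * (c ^ 3 * k\<^sup>2)" by simp
          then have "1 * (d * l * k) \<le> 17 / 125 * (c ^ 3 * k\<^sup>2) * (d * l * k)"
            using dl k by (intro mult_right_mono) auto
          also have "\<dots> = (4 * (17 / 25 * k\<^sup>2) * x) * (c\<^sup>2 * l * k / 20)"
            unfolding x_def by (simp add: power2_eq_square power3_eq_cube)
          finally show ?thesis by simp
        qed
        moreover have "cdot \<le> d * l * k"
        proof -
          have "d * l * (k - 5 / 8 * x) \<le> d * l * k" using dl x by (intro mult_left_mono) auto
          then show ?thesis using up by simp
        qed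
        ultimately show ?thesis unfolding P_def by linarith
      qed
    qed
  qed
  then have "end_drift_bound k \<Lambda> R d0" unfolding end_drift_bound_def by blast
  moreover have "R > 0" using R by simp
  ultimately show ?thesis using d0(1) by blast
qed

text \<open>On the circle, \<open>partials_euler\<close> eliminates the partial derivative in
  \<open>w\<close>. The right-hand side involves only integrals that \<open>end_integrals\<close>
  controls.\<close>

lemma tangential_partial:
  assumes F: "continuous_on {0..1} F" and circle: "w\<^sup>2 + b\<^sup>2 = 1"
  shows "w * (b * Lw F w b c - w * Lb F w b c) =
    - c * (b * (- Lc F w b c) + 2 * (c * pmean w b * (1 - pint step (\<lambda>_. 1) w b) - pint step F w b))"
proof -
  have m: "pint (\<lambda>y. 2 * max y 0) (\<lambda>_. 1) w b = 2 * pmean w b"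
    by (simp add: pint_def pmean_def)
  have "w * (b * Lw F w b c - w * Lb F w b c) = b * (w * Lw F w b c + b * Lb F w b c) - (w\<^sup>2 + b\<^sup>2) * Lb F w b c"
    by (simp add: power2_eq_square algebra_simps)
  also have "\<dots> = b * (c * Lc F w b c) - Lb F w b c"
    using partials_euler[OF F] circle by simp
  finally show ?thesis
    unfolding Lb_def m by (simp add: power2_eq_square algebra_simps)
qed

text \<open>Both endpoint values are small, so at most one is positive on the unit circle. The other
  endpoint contributes nothing, and \<open>end_drift\<close> applies at the active one, after a
  reflection if that is \<open>1\<close>.\<close>

lemma drift_ends:
  assumes F: "continuous_on {0..1} F"
    and lip: "\<And>s t. s \<in> {0..1} \<Longrightarrow> t \<in> {0..1} \<Longrightarrow> \<bar>F s - F t\<bar> \<le> \<Lambda> * \<bar>s - t\<bar>"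
    and X0: "X0 = (9 / 5 * max (F 0) 0)\<^sup>2" and X1: "X1 = (9 / 5 * max (F 1) 0)\<^sup>2"
  shows "\<exists>R>0. \<exists>\<delta>>0. \<delta> \<le> 1 / 10 \<and> (\<forall>w b c cdot q. w\<^sup>2 + b\<^sup>2 = 1 \<longrightarrow> b < \<delta> \<longrightarrow> w + b < \<delta> \<longrightarrow> R \<le> c \<longrightarrow>
    cdot = - Lc F w b c \<longrightarrow> q = b * Lw F w b c - w * Lb F w b c \<longrightarrow>
    cdot - 4 * max (X1 - (max (c * (w + b)) 0)\<^sup>2) 0 * max (c * (w + b)) 0 * (cdot * (w + b) + c * (w * q - b * q))
         - 4 * max (X0 - (max (c * b) 0)\<^sup>2) 0 * max (c * b) 0 * (cdot * b + c * (w * q)) \<le> 0)"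
proof -
  have L: "0 \<le> \<Lambda>" using lip[of 0 1] by simp
  obtain R0 \<delta>0 where R0: "R0 > 0" "\<delta>0 > 0" and b0: "end_drift_bound (F 0) \<Lambda> R0 \<delta>0"
    using end_drift[OF L] by blast
  obtain R1 \<delta>1 where R1: "R1 > 0" "\<delta>1 > 0" and b1: "end_drift_bound (F 1) \<Lambda> R1 \<delta>1"
    using end_drift[OF L] by blast
  note drift0 = b0[unfolded end_drift_bound_def X0[symmetric], rule_format]
    and drift1 = b1[unfolded end_drift_bound_def X1[symmetric], rule_format]
  define R where "R = max R0 R1"
  define \<delta> where "\<delta> = min (min \<delta>0 \<delta>1) (1 / 10)"
  have \<delta>: "\<delta> > 0" "\<delta> \<le> 1 / 10" "\<delta> \<le> \<delta>0" "\<delta> \<le> \<delta>1" using R0 R1 by (auto simp: \<delta>_def)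
  have "cdot - 4 * max (X1 - (max (c * (w + b)) 0)\<^sup>2) 0 * max (c * (w + b)) 0 * (cdot * (w + b) + c * (w * q - b * q))
         - 4 * max (X0 - (max (c * b) 0)\<^sup>2) 0 * max (c * b) 0 * (cdot * b + c * (w * q)) \<le> 0"
    if circle: "w\<^sup>2 + b\<^sup>2 = 1" and b: "b < \<delta>" and wb: "w + b < \<delta>" and c: "R \<le> c"
      and cdot: "cdot = - Lc F w b c" and q: "q = b * Lw F w b c - w * Lb F w b c" for w b c cdot q
  proof -
    have cR: "R0 \<le> c" "R1 \<le> c" "c > 0" using c R0(1) by (auto simp: R_def)
    have le1: "\<bar>w\<bar> \<le> 1" "\<bar>b\<bar> \<le> 1"
      using circle abs_le_square_iff[of w 1] abs_le_square_iff[of b 1] zero_le_power2[of w] zero_le_power2[of b]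
      by simp_all
    \<comment> \<open>Two positive values below \<open>1 / 10\<close> would make both
      \<open>w\<close> and \<open>b\<close> too small for the circle.\<close>
    have not_both: "b \<le> 0 \<or> w + b \<le> 0"
    proof (rule ccontr)
      assume "\<not> ?thesis"
      then have "\<bar>w\<bar> \<le> 1 / 10" "\<bar>b\<bar> \<le> 1 / 10" using b wb \<delta>(2) by auto
      then have "w\<^sup>2 \<le> (1 / 10)\<^sup>2" "b\<^sup>2 \<le> (1 / 10)\<^sup>2"
        using abs_le_square_iff[of w "1 / 10"] abs_le_square_iff[of b "1 / 10"] by simp_all
      then show False using circle by (simp add: power2_eq_square)
    qed
    consider "b \<le> 0" "w + b \<le> 0" | "b \<le> 0" "w + b > 0" | "b > 0" "w + b \<le> 0"
      using not_both by linarith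
    then show ?thesis
    proof cases
      case 1
      then have "max (c * b) 0 = 0" "max (c * (w + b)) 0 = 0" using cR(3) by (simp_all add: mult_nonneg_nonpos)
      moreover have "cdot = 0" using Lc_inactive[OF 1] by (simp add: cdot)
      ultimately show ?thesis by simp
    next
      case 2
      define d where "d = w + b"
      define l where "l = d / w"
      have d: "0 < d" "d \<le> w" "d \<le> \<delta>1" using 2 wb \<delta>(4) by (auto simp: d_def)
      then have w0: "0 < w" by simp
      \<comment> \<open>Here \<open>\<bar>b\<bar> \<le> w\<close>, so \<open>w < 1 / 2\<close> would
        force \<open>w\<^sup>2 + b\<^sup>2 < 1 / 2\<close>.\<close>
      have w: "1 / 2 \<le> w"
      proof (rule ccontr)
        assume "\<not> ?thesis"
        then have "\<bar>w\<bar> < 1 / 2" "\<bar>b\<bar> \<le> 1 / 2" using w0 2 by auto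
        then have "w\<^sup>2 < (1 / 2)\<^sup>2" "b\<^sup>2 \<le> (1 / 2)\<^sup>2"
          using abs_le_square_iff[of "1 / 2" w] abs_le_square_iff[of b "1 / 2"] by simp_all
        then show False using circle by (simp add: power2_eq_square)
      qed
      define Fr where "Fr s = F (1 - s)" for s
      have Fr0: "Fr 0 = F 1" by (simp add: Fr_def)
      have Fr: "continuous_on {0..1} Fr"
        unfolding Fr_def by (intro continuous_on_compose2[OF F] continuous_intros) auto
      have "\<bar>Fr s - Fr 0\<bar> \<le> \<Lambda> * s" if "s \<in> {0..1}" for s
        using lip[of "1 - s" 1] that by (simp add: Fr_def)
      note E = end_integrals[OF w0 d(1,2) Fr this, folded l_def]
      have mirror: "pint step F w b = pint step Fr (- w) d" "pcorr F w b = pcorr Fr (- w) d"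
        "pint step (\<lambda>_. 1) w b = pint step (\<lambda>_. 1) (- w) d"
        "pmean w b = pmean (- w) d" "psq w b = psq (- w) d"
        unfolding Fr_def d_def pcorr_def pmean_def psq_def by (rule pint_reflect)+
      have m: "pmean w b = d * l / 2" and st: "pint step (\<lambda>_. 1) w b = l"
        by (simp_all only: mirror(3,4) E(1,3))
      define I where "I = c * (d * l / 2) * (1 - l) - pint step F w b"
      have cd: "cdot = 2 * (pcorr F w b - c * (d\<^sup>2 * l / 3 - (d * l / 2)\<^sup>2))"
      proof -
        have "pvar w b = d\<^sup>2 * l / 3 - (d * l / 2)\<^sup>2" by (simp only: pvar_def mirror(4,5) E(1,2))
        then show ?thesis by (simp add: cdot Lc_def)
      qed
      have "w * q = - c * (b * cdot + 2 * I)"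
        using tangential_partial[OF F circle, of c] unfolding q I_def cdot
        by (simp add: m st)
      \<comment> \<open>The endpoint value \<open>w + b\<close> moves at speed
        \<open>(w - b) * q\<close>, whereas \<open>tangential_partial\<close> describes
        \<open>w * q\<close>. Their ratio is the parameter \<open>e\<close>, at least
        \<open>1\<close> because \<open>b \<le> 0 < w\<close>.\<close>
      then have "(w - b) / w * (w * q) = - (c * ((w - b) / w)) * (b * cdot + 2 * I)"
        by (simp only: mult_ac minus_mult_commute mult_minus_left mult_minus_right)
      then have "(w - b) * q = - (c * ((w - b) / w)) * (b * cdot + 2 * I)"
        using w0 by simp
      then have dd: "w * q - b * q = - (c * ((w - b) / w)) * (b * cdot + 2 * I)"
        by (simp only: left_diff_distrib)
      have e: "1 \<le> (w - b) / w" using w0 2 by (simp add: field_simps)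
      have "cdot - 4 * max (X1 - (c * d)\<^sup>2) 0 * (c * d) * (cdot * d + c * (w * q - b * q)) \<le> 0"
        using E(4,5) le1 w0
        by (intro drift1[OF cR(2) d(1,3) w _ l_def e le1(2) _ _ refl I_def cd dd]) (auto simp: mirror Fr0)
      moreover have "max (c * b) 0 = 0" "max (c * (w + b)) 0 = c * d"
        using 2 cR(3) by (simp_all add: mult_nonneg_nonpos d_def max_absorb1)
      ultimately show ?thesis by (simp add: d_def)
    next
      case 3
      define l where "l = b / (- w)"
      have w0: "0 < - w" and d: "b \<le> - w" "b \<le> \<delta>0" using 3 b \<delta>(3) by auto
      have w: "1 / 2 \<le> - w"
      proof (rule ccontr)
        assume "\<not> ?thesis"
        then have "\<bar>w\<bar> < 1 / 2" "\<bar>b\<bar> \<le> 1 / 2" using w0 3 by auto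
        then have "w\<^sup>2 < (1 / 2)\<^sup>2" "b\<^sup>2 \<le> (1 / 2)\<^sup>2"
          using abs_le_square_iff[of "1 / 2" w] abs_le_square_iff[of b "1 / 2"] by simp_all
        then show False using circle by (simp add: power2_eq_square)
      qed
      have "\<bar>F s - F 0\<bar> \<le> \<Lambda> * s" if "s \<in> {0..1}" for s
        using lip[of s 0] that by simp
      note E = end_integrals[OF w0 3(1) d(1) F this, folded l_def, simplified minus_minus]
      define I where "I = c * (b * l / 2) * (1 - l) - pint step F w b"
      have cd: "cdot = 2 * (pcorr F w b - c * (b\<^sup>2 * l / 3 - (b * l / 2)\<^sup>2))"
      proof -
        have "pvar w b = b\<^sup>2 * l / 3 - (b * l / 2)\<^sup>2" by (simp only: pvar_def E(1,2))
        then show ?thesis by (simp add: cdot Lc_def)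
      qed
      have m: "pmean w b = b * l / 2" and st: "pint step (\<lambda>_. 1) w b = l"
        by (simp_all only: E(1,3))
      have dd: "w * q = - (c * 1) * (b * cdot + 2 * I)"
        using tangential_partial[OF F circle, of c] unfolding q I_def cdot
        by (simp add: m st)
      have "cdot - 4 * max (X0 - (c * b)\<^sup>2) 0 * (c * b) * (cdot * b + c * (w * q)) \<le> 0"
        using E(4,5) le1
        by (intro drift0[OF cR(1) 3(1) d(2) w _ l_def order_refl le1(2) _ _ refl I_def cd dd]) auto
      moreover have "max (c * (w + b)) 0 = 0" "max (c * b) 0 = c * b"
        using 3 cR(3) by (simp_all add: mult_nonneg_nonpos max_absorb1)
      ultimately show ?thesis by simp
    qed
  qed
  moreover have "R > 0" using R0 by (simp add: R_def)
  ultimately show ?thesis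
    using \<delta>(1,2) by (intro exI[of _ R] exI[of _ \<delta>] conjI allI impI) assumption+
qed

section \<open>Upper bound for the output weight\<close>

text \<open>Mean value theorem with derivatives relative to a larger set \<open>S\<close>, which
  permits one-sided derivatives at time \<open>0\<close>.\<close>

lemma nonincreasing_of_deriv_nonpos:
  fixes W :: "real \<Rightarrow> real"
  assumes "x \<le> y" "\<And>t. t \<in> {x..y} \<Longrightarrow> (W has_real_derivative W' t) (at t within S) \<and> W' t \<le> 0" "{x..y} \<subseteq> S"
  shows "W y \<le> W x"
proof -
  have "\<exists>t\<in>{x..y}. W y - W x = (\<lambda>h. W' t * h) (y - x)"
  proof (rule mvt_very_simple[OF assms(1)])
    show "(W has_derivative (\<lambda>h. W' t * h)) (at t within {x..y})" if "x \<le> t" "t \<le> y" for t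
      using has_field_derivative_subset[OF conjunct1[OF assms(2)] assms(3), of t] that
      by (simp add: has_field_derivative_def)
  qed
  then obtain t where t: "t \<in> {x..y}" "W y - W x = W' t * (y - x)" by blast
  moreover have "W' t * (y - x) \<le> 0" using assms(1) conjunct2[OF assms(2)[OF t(1)]] by (intro mult_nonpos_nonneg) auto
  ultimately show ?thesis by linarith
qed

text \<open>The level set is compact and has a largest element; a later value below \<open>M\<close>
  would force a further crossing before \<open>y\<close>.\<close>

lemma last_crossing:
  fixes c :: "real \<Rightarrow> real"
  assumes "x \<le> y" "continuous_on {x..y} c" "c x \<le> M" "M \<le> c y"
  obtains z where "z \<in> {x..y}" "c z = M" "\<And>t. t \<in> {z..y} \<Longrightarrow> M \<le> c t"
proof -
  define S where "S = {t \<in> {x..y}. c t = M}"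
  have "closed S" unfolding S_def using continuous_closed_preimage_constant[OF assms(2)] by simp
  moreover have "bounded S" by (rule bounded_subset[of "{x..y}"]) (auto simp: S_def)
  ultimately have "compact S" by (simp add: compact_eq_bounded_closed)
  moreover have "S \<noteq> {}" using IVT'[OF assms(3,4,1,2)] by (auto simp: S_def)
  ultimately have "\<exists>z\<in>S. \<forall>t\<in>S. t \<le> z" by (rule compact_attains_sup)
  then obtain z where z: "z \<in> S" "\<And>t. t \<in> S \<Longrightarrow> t \<le> z" by blast
  have "M \<le> c t" if t: "t \<in> {z..y}" for t
  proof (rule ccontr)
    assume a: "\<not> M \<le> c t"
    have "continuous_on {t..y} c" using assms(2) z(1) t by (auto simp: S_def intro: continuous_on_subset)
    then obtain u where u: "t \<le> u" "u \<le> y" "c u = M" using IVT'[of c t M y] a t assms(4) by auto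
    then have "u \<in> S" using z(1) t by (auto simp: S_def)
    then have "u = t" using z(2) u t by force
    then show False using u a by simp
  qed
  moreover have "z \<in> {x..y}" "c z = M" using z(1) by (simp_all add: S_def)
  ultimately show thesis by (intro that)
qed

text \<open>Since the last time at which \<open>c\<close> had the value \<open>M\<close>, the
  variance has been small. The trajectory then stays in one of the two separated regions of
  \<open>pvar_pos_away\<close>, and each has its own monotone quantity. The three coordinates are
  abstract functions so that the sign-flipped flow is covered too.\<close>

lemma flow_upper_bound:
  fixes w b c F :: "real \<Rightarrow> real"
  assumes F: "continuous_on {0..1} F" "integral {0..1} F = 0"
    and lip: "\<And>s t. s \<in> {0..1} \<Longrightarrow> t \<in> {0..1} \<Longrightarrow> \<bar>F s - F t\<bar> \<le> \<Lambda> * \<bar>s - t\<bar>"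
    and q: "\<And>t. q t = b t * Lw F (w t) (b t) (c t) - w t * Lb F (w t) (b t) (c t)"
    and dw: "\<And>t. 0 \<le> t \<Longrightarrow> (w has_real_derivative - (b t * q t)) (at t within {0..})"
    and db: "\<And>t. 0 \<le> t \<Longrightarrow> (b has_real_derivative w t * q t) (at t within {0..})"
    and dc: "\<And>t. 0 \<le> t \<Longrightarrow> (c has_real_derivative - Lc F (w t) (b t) (c t)) (at t within {0..})"
    and circle: "\<And>t. 0 \<le> t \<Longrightarrow> (w t)\<^sup>2 + (b t)\<^sup>2 = 1"
    and K: "\<And>t. 0 \<le> t \<Longrightarrow> (c t)\<^sup>2 * pvar (w t) (b t) \<le> K"
  shows "\<exists>B. \<forall>t\<ge>0. c t \<le> B"
proof -
  define X0 where "X0 = (9 / 5 * max (F 0) 0)\<^sup>2"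
  define X1 where "X1 = (9 / 5 * max (F 1) 0)\<^sup>2"
  obtain R \<delta> where R: "R > 0" "\<delta> > 0" "\<delta> \<le> 1 / 10" and drift: "\<forall>w b c cdot q. w\<^sup>2 + b\<^sup>2 = 1 \<longrightarrow> b < \<delta> \<longrightarrow> w + b < \<delta> \<longrightarrow> R \<le> c \<longrightarrow>
    cdot = - Lc F w b c \<longrightarrow> q = b * Lw F w b c - w * Lb F w b c \<longrightarrow>
    cdot - 4 * max (X1 - (max (c * (w + b)) 0)\<^sup>2) 0 * max (c * (w + b)) 0 * (cdot * (w + b) + c * (w * q - b * q))
         - 4 * max (X0 - (max (c * b) 0)\<^sup>2) 0 * max (c * b) 0 * (cdot * b + c * (w * q)) \<le> 0"
    using drift_ends[OF F(1) lip X0_def X1_def] by blast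
  obtain \<eta> where \<eta>: "\<eta> > 0" "\<And>w b. w\<^sup>2 + b\<^sup>2 = 1 \<Longrightarrow> pvar w b \<le> \<eta> \<Longrightarrow> 4 / 5 < b \<or> (b < \<delta> \<and> w + b < \<delta>)"
    using pvar_pos_away[OF R(2)] by blast
  \<comment> \<open>\<open>R\<close> is for the drift estimate, and \<open>c 0\<close> lets the
    trajectory start below \<open>M\<close>. With \<open>1\<close> and \<open>K / \<eta>\<close> one
    gets \<open>c\<^sup>2 \<ge> c \<ge> K / \<eta>\<close>, hence variance at most
    \<open>\<eta>\<close>.\<close>
  define M where "M = Max {R, 1, K / \<eta>, c 0}"
  have M: "R \<le> M" "1 \<le> M" "K / \<eta> \<le> M" "c 0 \<le> M" by (auto simp: M_def)
  have region: "4 / 5 < b t \<or> (b t < \<delta> \<and> w t + b t < \<delta>)" if t: "0 \<le> t" "M \<le> c t" for t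
  proof (rule \<eta>(2)[OF circle[OF t(1)]])
    have "c t * 1 \<le> c t * c t" using M t by (intro mult_left_mono) auto
    then have "K / \<eta> \<le> (c t)\<^sup>2" using M t unfolding power2_eq_square by linarith
    then have "K \<le> (c t)\<^sup>2 * \<eta>" using \<eta>(1) by (simp add: divide_le_eq)
    then have "(c t)\<^sup>2 * pvar (w t) (b t) \<le> (c t)\<^sup>2 * \<eta>" using K[OF t(1)] by simp
    then show "pvar (w t) (b t) \<le> \<eta>" using M t by (simp add: mult_le_cancel_left)
  qed
  have "c y \<le> M + X0\<^sup>2 + X1\<^sup>2 + 1" if y: "0 \<le> y" for y
  proof (cases "c y \<le> M")
    case True
    then show ?thesis using zero_le_power2[of X0] zero_le_power2[of X1] by linarith
  next
    case False
    have cc: "continuous_on {0..} c" and cb: "continuous_on {0..} b"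
      using dc db by (auto intro!: DERIV_continuous_on)
    obtain x where x: "x \<in> {0..y}" "c x = M" "\<And>t. t \<in> {x..y} \<Longrightarrow> M \<le> c t"
    proof (rule last_crossing[of 0 y c M])
      show "continuous_on {0..y} c" using cc by (rule continuous_on_subset) auto
    qed (use y M(4) False in auto)
    have sub: "{x..y} \<subseteq> {0..}" and xy: "x \<le> y" using x(1) by auto
    have reg: "4 / 5 < b t \<or> (b t < \<delta> \<and> w t + b t < \<delta>)" if "t \<in> {x..y}" for t
      using region[OF _ x(3)[OF that]] that x(1) by simp
    \<comment> \<open>As \<open>\<delta> \<le> 1 / 10\<close>, a change of region would take
      \<open>b\<close> through \<open>1 / 2\<close>, which neither region allows.\<close>
    have "connected (b ` {x..y})"
      using continuous_on_subset[OF cb sub] by (intro connected_continuous_image) auto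
    then have "(\<forall>t\<in>{x..y}. 4 / 5 < b t) \<or> (\<forall>t\<in>{x..y}. b t < \<delta> \<and> w t + b t < \<delta>)"
    proof (rule contrapos_pp)
      assume "\<not> ?thesis"
      then obtain s t where s: "s \<in> {x..y}" "\<not> 4 / 5 < b s" and t: "t \<in> {x..y}" "\<not> (b t < \<delta> \<and> w t + b t < \<delta>)"
        by blast
      then have "b s < \<delta>" "4 / 5 < b t" using reg[OF s(1)] reg[OF t(1)] by auto
      then have "b s \<le> 1 / 2" "1 / 2 \<le> b t" using R(3) by auto
      show "\<not> connected (b ` {x..y})"
      proof
        assume "connected (b ` {x..y})"
        then have "1 / 2 \<in> b ` {x..y}"
          by (rule connectedD_interval[OF _ imageI[OF s(1)] imageI[OF t(1)]]) fact+
        then obtain u where "u \<in> {x..y}" "b u = 1 / 2" by auto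
        then show False using reg[of u] R(3) by auto
      qed
    qed
    then show ?thesis
    proof
      assume b: "\<forall>t\<in>{x..y}. 4 / 5 < b t"
      \<comment> \<open>Conserved where the neuron is fully active: with \<open>Lb = 0\<close> one
        has \<open>q = b * Lw\<close>, and \<open>partials_euler\<close> gives
        \<open>w * Lw = c * Lc\<close>, so the two derivatives cancel.\<close>
      define H where "H t = (c t)\<^sup>2 + 2 * ln (b t)" for t
      have H: "H y \<le> H x"
      proof (rule nonincreasing_of_deriv_nonpos[OF xy _ sub, of _ "\<lambda>_. 0"], rule conjI)
        fix t assume t: "t \<in> {x..y}"
        then have t0: "0 \<le> t" and bt: "4 / 5 < b t" using sub b by auto
        have "\<bar>w t\<bar> < 4 / 5"
        proof (rule power2_less_imp_less)
          have "(4 / 5)\<^sup>2 < (b t)\<^sup>2" using bt by (intro power_strict_mono) auto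
          then show "\<bar>w t\<bar>\<^sup>2 < (4 / 5)\<^sup>2" using circle[OF t0] by (simp add: power2_eq_square)
        qed simp
        then have "Lb F (w t) (b t) (c t) = 0" using bt F(2) by (intro Lb_fully_active) auto
        then have "w t * Lw F (w t) (b t) (c t) = c t * Lc F (w t) (b t) (c t)" "q t = b t * Lw F (w t) (b t) (c t)"
          using partials_euler[OF F(1), of "w t" "b t" "c t"] q by simp_all
        then have "2 * c t * - Lc F (w t) (b t) (c t) + 2 * (w t * q t / b t) = 0" using bt by simp
        then show "(H has_real_derivative 0) (at t within {0..})"
          unfolding H_def using bt by (auto intro!: derivative_eq_intros dc[OF t0] db[OF t0] simp: field_simps)
      qed simp
      have "b x \<le> 1"
      proof (rule power2_le_imp_le)
        have "(w x)\<^sup>2 + (b x)\<^sup>2 = 1" using circle x(1) by simp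
        then show "(b x)\<^sup>2 \<le> 1\<^sup>2" using zero_le_power2[of "w x"] unfolding one_power2 by linarith
      qed simp
      moreover have "0 < b x" using b[rule_format, of x] xy by simp
      ultimately have "ln (b x) \<le> 0" by (simp only: ln_le_zero_iff)
      \<comment> \<open>With \<open>ln (b x) \<le> 0\<close> this limits the growth of
        \<open>c\<^sup>2\<close> to \<open>1 / 2\<close>.\<close>
      moreover have "ln (b y) \<ge> - (1 / 4)"
      proof -
        have b45: "4 / 5 < b y" using b xy by simp
        have "ln (1 / b y) \<le> 1 / b y - 1" using b45 by (intro ln_le_minus_one) auto
        also have "\<dots> \<le> 1 / 4" using b45 by (simp add: field_simps)
        finally show ?thesis using b45 by (simp add: ln_div)
      qed
      ultimately have "(c y)\<^sup>2 \<le> M\<^sup>2 + 1 / 2" using H by (simp add: H_def x(2))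
      also have "\<dots> \<le> (M + 1)\<^sup>2" using M(2) by (simp add: power2_sum)
      finally have "c y \<le> M + 1" by (rule power2_le_imp_le) (use M(2) in simp)
      then show ?thesis using zero_le_power2[of X0] zero_le_power2[of X1] by linarith
    next
      assume reg: "\<forall>t\<in>{x..y}. b t < \<delta> \<and> w t + b t < \<delta>"
      define \<rho> :: "real \<Rightarrow> real" where "\<rho> z = (max z 0)\<^sup>2" for z
      \<comment> \<open>The inner \<open>\<rho>\<close> ignores an inactive endpoint, the outer one
        stops the correction once \<open>c d\<close> reaches its threshold. The correction lies
        between \<open>0\<close> and \<open>X1\<^sup>2 + X0\<^sup>2\<close>, so monotonicity of
        \<open>W\<close> bounds \<open>c\<close>.\<close>
      define W where "W t = c t + \<rho> (X1 - \<rho> (c t * (w t + b t))) + \<rho> (X0 - \<rho> (c t * b t))" for t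
      have d\<rho>: "((\<lambda>t. \<rho> (g t)) has_real_derivative 2 * max (g t) 0 * g') (at t within {0..})"
        if "(g has_real_derivative g') (at t within {0..})" for g g' t
        unfolding \<rho>_def using DERIV_chain2[OF DERIV_relu_sq that] .
      have "W y \<le> W x"
      proof (rule nonincreasing_of_deriv_nonpos[OF xy _ sub], rule conjI)
        fix t assume t: "t \<in> {x..y}"
        then have t0: "0 \<le> t" using sub by auto
        let ?cd = "- Lc F (w t) (b t) (c t)"
        note D = dw[OF t0] db[OF t0] dc[OF t0]
        show "(W has_real_derivative ?cd
          + 2 * max (X1 - \<rho> (c t * (w t + b t))) 0 * (0 - 2 * max (c t * (w t + b t)) 0 *
              (?cd * (w t + b t) + (- (b t * q t) + w t * q t) * c t))
          + 2 * max (X0 - \<rho> (c t * b t)) 0 * (0 - 2 * max (c t * b t) 0 *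
              (?cd * b t + (w t * q t) * c t))) (at t within {0..})"
          unfolding W_def
          by (intro DERIV_add DERIV_diff DERIV_mult DERIV_const d\<rho> D)
        have "?cd - 4 * max (X1 - (max (c t * (w t + b t)) 0)\<^sup>2) 0 * max (c t * (w t + b t)) 0 *
              (?cd * (w t + b t) + c t * (w t * q t - b t * q t))
           - 4 * max (X0 - (max (c t * b t) 0)\<^sup>2) 0 * max (c t * b t) 0 * (?cd * b t + c t * (w t * q t)) \<le> 0"
          using drift[rule_format, OF circle[OF t0] _ _ _ refl q] reg t x(3)[OF t] M(1) by simp
        then show "?cd
          + 2 * max (X1 - \<rho> (c t * (w t + b t))) 0 * (0 - 2 * max (c t * (w t + b t)) 0 *
              (?cd * (w t + b t) + (- (b t * q t) + w t * q t) * c t))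
          + 2 * max (X0 - \<rho> (c t * b t)) 0 * (0 - 2 * max (c t * b t) 0 *
              (?cd * b t + (w t * q t) * c t)) \<le> 0"
          unfolding \<rho>_def by (simp add: algebra_simps)
      qed
      moreover have "c y \<le> W y" by (simp add: W_def \<rho>_def)
      moreover have \<rho>_le: "\<rho> (X - \<rho> z) \<le> X\<^sup>2" if "X \<ge> 0" for X z
        unfolding \<rho>_def using that by (intro power_mono) auto
      have "0 \<le> X0" "0 \<le> X1" by (simp_all add: X0_def X1_def)
      then have "W x \<le> c x + X1\<^sup>2 + X0\<^sup>2"
        unfolding W_def by (intro add_mono order_refl \<rho>_le)
      ultimately show ?thesis using x(2) by linarith
    qed
  qed
  then show ?thesis by blast
qed

section \<open>The gradient flow\<close>

lemma inner_sq_gderiv: "GDERIV inner_sq \<theta> :> vector [2 * \<theta>$1, 2 * \<theta>$2, 0]"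
proof -
  have "((\<lambda>\<theta>::real^3. \<theta>$i) has_derivative (\<lambda>h. h$i)) (at \<theta>)" for i
    by (rule bounded_linear_imp_has_derivative[OF bounded_linear_vec_nth])
  note D = this[of 1] this[of 2]
  have "((\<lambda>\<theta>::real^3. (\<theta>$1)\<^sup>2 + (\<theta>$2)\<^sup>2) has_derivative (\<lambda>h. h \<bullet> vector [2 * \<theta>$1, 2 * \<theta>$2, 0])) (at \<theta>)"
    by (rule has_derivative_eq_rhs, (rule has_derivative_add has_derivative_power D)+)
      (simp add: fun_eq_iff inner_vec_def sum_3 algebra_simps)
  then show ?thesis unfolding gderiv_def inner_sq_def by simp
qed

context
  fixes f F :: "real \<Rightarrow> real" and G :: "real^3 \<Rightarrow> real^3" and \<Theta> :: "real \<Rightarrow> real^3"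
  assumes f_cont: "continuous_on {0..1} f"
    and F_def: "F = (\<lambda>s. f s - fmean f)"
    and G_eq: "\<And>\<theta>. \<bar>\<theta>$1\<bar> + \<bar>\<theta>$2\<bar> > 0 \<Longrightarrow>
      G \<theta> = grad (risk f) \<theta>
        - (inverse ((norm (grad inner_sq \<theta>))\<^sup>2) * (grad (risk f) \<theta> \<bullet> grad inner_sq \<theta>))
            *\<^sub>R grad inner_sq \<theta>"
    and init: "\<Theta> 0 \<in> norm_manifold"
    and flow: "gradient_flow G \<Theta>"
begin

lemma F_cont: "continuous_on {0..1} F"
  unfolding F_def using f_cont by (intro continuous_intros)

lemma G_components:
  fixes \<theta> :: "real^3"
  defines "Pw \<equiv> Lw F (\<theta>$1) (\<theta>$2) (\<theta>$3)" and "Pb \<equiv> Lb F (\<theta>$1) (\<theta>$2) (\<theta>$3)"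
  assumes nz: "\<theta>$1 \<noteq> 0 \<or> \<theta>$2 \<noteq> 0"
  shows "G \<theta> $ 1 = Pw - (Pw * \<theta>$1 + Pb * \<theta>$2) * \<theta>$1 / ((\<theta>$1)\<^sup>2 + (\<theta>$2)\<^sup>2)"
    "G \<theta> $ 2 = Pb - (Pw * \<theta>$1 + Pb * \<theta>$2) * \<theta>$2 / ((\<theta>$1)\<^sup>2 + (\<theta>$2)\<^sup>2)"
    "G \<theta> $ 3 = Lc F (\<theta>$1) (\<theta>$2) (\<theta>$3)"
proof -
  let ?n = "(\<theta>$1)\<^sup>2 + (\<theta>$2)\<^sup>2"
  define N where "N = ?n"
  have g: "grad inner_sq \<theta> = vector [2 * \<theta>$1, 2 * \<theta>$2, 0]"
    by (rule grad_eqI[OF inner_sq_gderiv])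
  have r: "grad (risk f) \<theta> = vector [Pw, Pb, Lc F (\<theta>$1) (\<theta>$2) (\<theta>$3)]"
    unfolding Pw_def Pb_def by (rule grad_eqI[OF risk_gderiv[OF f_cont F_def nz]])
  have N: "(norm (vector [2 * \<theta>$1, 2 * \<theta>$2, 0] :: real^3))\<^sup>2 = 4 * ?n"
    unfolding power2_norm_eq_inner by (simp add: inner_vec_def sum_3 power2_eq_square)
  have pos: "\<bar>\<theta>$1\<bar> + \<bar>\<theta>$2\<bar> > 0" using nz by auto
  have coeff: "inverse (4 * n) * (vector [Pw, Pb, x] \<bullet> (vector [2 * \<theta>$1, 2 * \<theta>$2, 0] :: real^3))
      = (Pw * \<theta>$1 + Pb * \<theta>$2) / (2 * n)" for x n
    by (cases "n = 0") (simp_all add: inner_vec_def sum_3 field_simps)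
  from G_eq[OF pos, unfolded g r N coeff]
  have G: "G \<theta> = vector [Pw, Pb, Lc F (\<theta>$1) (\<theta>$2) (\<theta>$3)] -
      ((Pw * \<theta>$1 + Pb * \<theta>$2) / (2 * N)) *\<^sub>R vector [2 * \<theta>$1, 2 * \<theta>$2, 0]"
    unfolding N_def .
  show "G \<theta> $ 1 = Pw - (Pw * \<theta>$1 + Pb * \<theta>$2) * \<theta>$1 / ?n"
    "G \<theta> $ 2 = Pb - (Pw * \<theta>$1 + Pb * \<theta>$2) * \<theta>$2 / ?n"
    "G \<theta> $ 3 = Lc F (\<theta>$1) (\<theta>$2) (\<theta>$3)"
    unfolding G N_def[symmetric] by simp_all
qed

text \<open>\<open>G\<close> is the gradient of the risk projected orthogonally to that of
  \<open>inner_sq\<close>, so the flow conserves \<open>inner_sq\<close> away from its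
  zeros.\<close>

lemma G_tangential:
  fixes \<theta> :: "real^3"
  assumes nz: "\<theta>$1 \<noteq> 0 \<or> \<theta>$2 \<noteq> 0"
  shows "\<theta>$1 * G \<theta> $ 1 + \<theta>$2 * G \<theta> $ 2 = 0"
proof -
  have "x * (P - S * x / n) + y * (Q - S * y / n) = (x * P + y * Q) - S * ((x\<^sup>2 + y\<^sup>2) / n)"
    for x y P Q S n :: real
    by (simp add: power2_eq_square add_divide_distrib algebra_simps)
  moreover have "(\<theta>$1)\<^sup>2 + (\<theta>$2)\<^sup>2 \<noteq> 0" using nz by (simp add: sum_power2_eq_zero_iff)
  ultimately show ?thesis unfolding G_components[OF nz] by simp
qed

text \<open>The explicit formula holds on an open set around the point, so \<open>G\<close> inherits
  the continuity of the partial derivatives there.\<close>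

lemma G_isCont:
  assumes nz: "\<theta>$1 \<noteq> 0 \<or> \<theta>$2 \<noteq> 0"
  shows "isCont G \<theta>"
proof -
  have "isCont (\<lambda>\<theta>. G \<theta> $ i) \<theta>" for i
  proof -
    let ?Pw = "\<lambda>\<theta>::real^3. Lw F (\<theta>$1) (\<theta>$2) (\<theta>$3)" and ?Pb = "\<lambda>\<theta>::real^3. Lb F (\<theta>$1) (\<theta>$2) (\<theta>$3)"
    let ?h = "\<lambda>\<theta>::real^3. if i = 1 then ?Pw \<theta> - (?Pw \<theta> * \<theta>$1 + ?Pb \<theta> * \<theta>$2) * \<theta>$1 / ((\<theta>$1)\<^sup>2 + (\<theta>$2)\<^sup>2)
      else if i = 2 then ?Pb \<theta> - (?Pw \<theta> * \<theta>$1 + ?Pb \<theta> * \<theta>$2) * \<theta>$2 / ((\<theta>$1)\<^sup>2 + (\<theta>$2)\<^sup>2)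
      else Lc F (\<theta>$1) (\<theta>$2) (\<theta>$3)"
    have op: "open {\<theta>::real^3. \<theta>$1 \<noteq> 0 \<or> \<theta>$2 \<noteq> 0}"
      by (intro open_Collect_disj open_Collect_neq continuous_intros)
    have "(\<theta>$1)\<^sup>2 + (\<theta>$2)\<^sup>2 \<noteq> 0" using nz by (simp add: sum_power2_eq_zero_iff)
    then have "isCont ?h \<theta>"
      using partials_continuous[OF F_cont nz] by (cases "i = 1"; cases "i = 2") (auto intro!: continuous_intros)
    moreover have "\<forall>\<^sub>F \<theta> in nhds \<theta>. \<theta> \<in> {\<theta>::real^3. \<theta>$1 \<noteq> 0 \<or> \<theta>$2 \<noteq> 0}"
      by (rule eventually_nhds_in_open[OF op]) (use nz in simp)
    then have "\<forall>\<^sub>F \<theta> in nhds \<theta>. G \<theta> $ i = ?h \<theta>"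
    proof (rule eventually_mono)
      fix \<theta> :: "real^3" assume "\<theta> \<in> {\<theta>. \<theta>$1 \<noteq> 0 \<or> \<theta>$2 \<noteq> 0}"
      then have "\<theta>$1 \<noteq> 0 \<or> \<theta>$2 \<noteq> 0" by simp
      note C = G_components[OF this]
      consider "i = 1" | "i = 2" | "i = 3" using exhaust_3 by blast
      then show "G \<theta> $ i = ?h \<theta>" by cases (simp_all add: C)
    qed
    ultimately show ?thesis using isCont_cong by fast
  qed
  then show ?thesis unfolding isCont_def by (rule vec_tendstoI)
qed

section \<open>Regularity of the trajectory\<close>

lemma flow_eq: "0 \<le> t \<Longrightarrow> \<Theta> t = \<Theta> 0 - integral {0..t} (\<lambda>u. G (\<Theta> u))"
  by (rule conjunct2[OF flow[unfolded gradient_flow_def, rule_format]])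

lemma flow_integrable: "0 \<le> t \<Longrightarrow> (\<lambda>u. G (\<Theta> u)) integrable_on {0..t}"
  by (rule set_lebesgue_integral_eq_integral(1)[OF conjunct1[OF flow[unfolded gradient_flow_def, rule_format]]])

lemma flow_continuous: "continuous_on {0..} \<Theta>"
proof -
  have "continuous_on {0..T} \<Theta>" if "T \<ge> 0" for T
  proof -
    have "continuous_on {0..T} (\<lambda>t. \<Theta> 0 - integral {0..t} (\<lambda>u. G (\<Theta> u)))"
      by (intro continuous_intros indefinite_integral_continuous_1 flow_integrable that)
    then show ?thesis by (rule continuous_on_eq) (rule flow_eq[symmetric], simp)
  qed
  then show ?thesis
    unfolding continuous_on_eq_continuous_within
  proof (intro ballI)
    fix t :: real assume c: "\<And>T. 0 \<le> T \<Longrightarrow> \<forall>x\<in>{0..T}. continuous (at x within {0..T}) \<Theta>" and t: "t \<in> {0..}"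
    have "at t within {0..} = at t within {0..t + 1}"
      by (rule at_within_nhd[of _ "{..<t + 1}"]) auto
    then show "continuous (at t within {0..}) \<Theta>" using c[of "t + 1"] t by simp
  qed
qed

text \<open>Fundamental theorem of calculus at a point where the integrand is continuous; this is
  the only place where the integral equation is differentiated.\<close>

lemma flow_has_vector_derivative:
  assumes t: "0 \<le> t" and nz: "\<Theta> t $ 1 \<noteq> 0 \<or> \<Theta> t $ 2 \<noteq> 0"
  shows "(\<Theta> has_vector_derivative - G (\<Theta> t)) (at t within {0..})"
proof -
  have nhd: "at t within {0..} = at t within {0..t + 1}"
    by (rule at_within_nhd[of _ "{..<t + 1}"]) (use t in auto)
  have int: "(\<lambda>u. G (\<Theta> u)) integrable_on {0..t + 1}"
    by (rule flow_integrable) (use t in simp)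
  have "continuous (at t within {0..}) \<Theta>"
    using flow_continuous t by (simp add: continuous_on_eq_continuous_within)
  then have "continuous (at t within {0..t + 1}) (\<lambda>u. G (\<Theta> u))"
    unfolding nhd using G_isCont[OF nz] by (rule continuous_within_compose3[rotated])
  then have "((\<lambda>u. integral {0..u} (\<lambda>u. G (\<Theta> u))) has_vector_derivative G (\<Theta> t)) (at t within {0..t + 1})"
    using integral_has_vector_derivative_continuous_at[OF int, of t "{}"] t by simp
  then have D: "((\<lambda>u. \<Theta> 0 - integral {0..u} (\<lambda>u. G (\<Theta> u))) has_vector_derivative 0 - G (\<Theta> t)) (at t within {0..t + 1})"
    by (intro has_vector_derivative_diff has_vector_derivative_const)
  have "(\<Theta> has_vector_derivative 0 - G (\<Theta> t)) (at t within {0..t + 1})"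
  proof (rule has_vector_derivative_transform[OF _ _ D])
    show "t \<in> {0..t + 1}" using t by simp
    show "\<Theta> u = \<Theta> 0 - integral {0..u} (\<lambda>u. G (\<Theta> u))" if "u \<in> {0..t + 1}" for u
      by (rule flow_eq) (use that in simp)
  qed
  then show ?thesis by (simp add: nhd)
qed

lemma flow_component_derivative:
  assumes "0 \<le> t" "\<Theta> t $ 1 \<noteq> 0 \<or> \<Theta> t $ 2 \<noteq> 0"
  shows "((\<lambda>t. \<Theta> t $ i) has_real_derivative - (G (\<Theta> t) $ i)) (at t within {0..})"
  using bounded_linear.has_vector_derivative[OF bounded_linear_vec_nth flow_has_vector_derivative[OF assms], of i]
  by (simp add: has_real_derivative_iff_has_vector_derivative)

text \<open>The squared excess of \<open>g(\<Theta>)\<close> over \<open>1/2\<close> is differentiable even where the flow is not, namely at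
  \<open>g(\<Theta>) = 0\<close>.\<close>

lemma flow_on_circle:
  assumes t: "0 \<le> t"
  shows "(\<Theta> t $ 1)\<^sup>2 + (\<Theta> t $ 2)\<^sup>2 = 1"
proof -
  define g where "g t = (\<Theta> t $ 1)\<^sup>2 + (\<Theta> t $ 2)\<^sup>2" for t
  have gc: "continuous_on {0..} g"
    unfolding g_def by (intro continuous_intros flow_continuous)
  have "((\<lambda>t. (max (g t - 1 / 2) 0)\<^sup>2) has_real_derivative 0) (at t within {0..})" if t: "t \<in> {0..}" for t
  proof (cases "g t = 0")
    case False
    then have nz: "\<Theta> t $ 1 \<noteq> 0 \<or> \<Theta> t $ 2 \<noteq> 0" by (auto simp: g_def)
    have t0: "0 \<le> t" using t by simp
    note D = flow_component_derivative[OF t0 nz]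
    have "2 * \<Theta> t $ 1 * - (G (\<Theta> t) $ 1) + 2 * \<Theta> t $ 2 * - (G (\<Theta> t) $ 2) = 0"
      using G_tangential[OF nz] by (simp add: algebra_simps)
    then have "(g has_real_derivative 0) (at t within {0..})"
      unfolding g_def by (auto intro!: derivative_eq_intros D simp: algebra_simps)
    then have "((\<lambda>t. g t - 1 / 2) has_real_derivative 0) (at t within {0..})"
      by (auto intro!: derivative_eq_intros)
    from DERIV_chain2[OF DERIV_relu_sq this] show ?thesis by simp
  next
    case True
    \<comment> \<open>Near a zero of \<open>g\<close> the truncated excess vanishes identically by
      continuity alone, whatever \<open>G\<close> does there.\<close>
    have "\<forall>\<^sub>F s in at t within {0..}. g s < 1 / 2"
      using gc t True by (intro order_tendstoD(2)) (auto simp: continuous_on_def)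
    then have ev: "\<forall>\<^sub>F s in at t within {0..}. 0 = (max (g s - 1 / 2) 0)\<^sup>2"
      by eventually_elim simp
    show ?thesis
      unfolding has_field_derivative_def
    proof (rule has_derivative_transform_eventually[OF _ ev])
      show "((\<lambda>_. 0) has_derivative (*) 0) (at t within {0..})"
        using DERIV_const[where k=0 and F="at t within {0..}"] by (simp only: has_field_derivative_def)
    qed (use True t in simp_all)
  qed
  then have "\<exists>k. \<forall>t\<in>{0..}. (max (g t - 1 / 2) 0)\<^sup>2 = k"
    by (intro has_field_derivative_zero_constant) auto
  then have "(max (g t - 1 / 2) 0)\<^sup>2 = (max (g 0 - 1 / 2) 0)\<^sup>2" using t by force
  moreover have "max (g 0 - 1 / 2) 0 = 1 / 2"
    using init by (simp add: g_def norm_manifold_def inner_sq_def)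
  ultimately have "(max (g t - 1 / 2) 0)\<^sup>2 = (1 / 2)\<^sup>2" by (simp only:)
  then have "max (g t - 1 / 2) 0 = 1 / 2" by (rule power2_eq_imp_eq) simp_all
  then have "g t = 1" by linarith
  then show ?thesis by (simp add: g_def)
qed

lemma flow_nonzero:
  assumes "0 \<le> t"
  shows "\<Theta> t $ 1 \<noteq> 0 \<or> \<Theta> t $ 2 \<noteq> 0"
  using flow_on_circle[OF assms] by auto

text \<open>On the unit circle, projecting away from \<open>(w, b)\<close> means projecting onto the
  unit tangent \<open>(b, - w)\<close>; \<open>q\<close> is the component of the gradient in that
  direction.\<close>

lemma flow_tangential:
  assumes t: "0 \<le> t"
    and q: "q = \<Theta> t $ 2 * Lw F (\<Theta> t $ 1) (\<Theta> t $ 2) (\<Theta> t $ 3) - \<Theta> t $ 1 * Lb F (\<Theta> t $ 1) (\<Theta> t $ 2) (\<Theta> t $ 3)"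
  shows "G (\<Theta> t) $ 1 = \<Theta> t $ 2 * q" "G (\<Theta> t) $ 2 = - (\<Theta> t $ 1 * q)"
    "G (\<Theta> t) $ 3 = Lc F (\<Theta> t $ 1) (\<Theta> t $ 2) (\<Theta> t $ 3)"
proof -
  note C = G_components[OF flow_nonzero[OF t], unfolded flow_on_circle[OF t]]
  let ?w = "\<Theta> t $ 1" and ?b = "\<Theta> t $ 2"
  let ?Pw = "Lw F ?w ?b (\<Theta> t $ 3)" and ?Pb = "Lb F ?w ?b (\<Theta> t $ 3)"
  have "?Pw - (?Pw * ?w + ?Pb * ?b) * ?w = ?Pw * (1 - ?w\<^sup>2) - ?Pb * ?b * ?w"
    by (simp add: power2_eq_square algebra_simps)
  also have "1 - ?w\<^sup>2 = ?b\<^sup>2" using flow_on_circle[OF t] by simp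
  finally show "G (\<Theta> t) $ 1 = ?b * q"
    using C(1) unfolding q by (simp add: power2_eq_square algebra_simps)
  have "?Pb - (?Pw * ?w + ?Pb * ?b) * ?b = ?Pb * (1 - ?b\<^sup>2) - ?Pw * ?b * ?w"
    by (simp add: power2_eq_square algebra_simps)
  also have "1 - ?b\<^sup>2 = ?w\<^sup>2" using flow_on_circle[OF t] by simp
  finally show "G (\<Theta> t) $ 2 = - (?w * q)"
    using C(2) unfolding q by (simp add: power2_eq_square algebra_simps)
  show "G (\<Theta> t) $ 3 = Lc F ?w ?b (\<Theta> t $ 3)" by (rule C(3))
qed

text \<open>Along the flow the risk has derivative \<open>- (q\<^sup>2 + Lc\<^sup>2)\<close>: the
  projected gradient pairs with the full gradient to its own squared norm.\<close>

lemma risk_flow_le: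
  assumes "0 \<le> t"
  shows "risk f (\<Theta> t) \<le> risk f (\<Theta> 0)"
proof (rule nonincreasing_of_deriv_nonpos[OF assms, of "\<lambda>t. risk f (\<Theta> t)" _ "{0..}"], rule conjI)
  fix u assume "u \<in> {0..t}"
  then have u: "0 \<le> u" by simp
  let ?w = "\<Theta> u $ 1" and ?b = "\<Theta> u $ 2" and ?c = "\<Theta> u $ 3"
  let ?D = "vector [Lw F ?w ?b ?c, Lb F ?w ?b ?c, Lc F ?w ?b ?c] :: real^3"
  define q where "q = ?b * Lw F ?w ?b ?c - ?w * Lb F ?w ?b ?c"
  have "(risk f has_derivative (\<lambda>h. h \<bullet> ?D)) (at (\<Theta> u))"
    using risk_gderiv[OF f_cont F_def flow_nonzero[OF u]] by (simp add: gderiv_def)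
  moreover have "(\<Theta> has_derivative (\<lambda>h. h *\<^sub>R - G (\<Theta> u))) (at u within {0..})"
    using flow_has_vector_derivative[OF u flow_nonzero[OF u]] by (simp add: has_vector_derivative_def)
  ultimately have "((\<lambda>t. risk f (\<Theta> t)) has_derivative (\<lambda>h. (h *\<^sub>R - G (\<Theta> u)) \<bullet> ?D)) (at u within {0..})"
    by (rule has_derivative_compose[rotated])
  then show "((\<lambda>t. risk f (\<Theta> t)) has_real_derivative - (G (\<Theta> u) \<bullet> ?D)) (at u within {0..})"
    unfolding has_field_derivative_def by (rule has_derivative_eq_rhs) (simp add: fun_eq_iff)
  have "G (\<Theta> u) \<bullet> ?D = q\<^sup>2 + (Lc F ?w ?b ?c)\<^sup>2"
    by (simp add: inner_vec_def sum_3 flow_tangential[OF u q_def] power2_eq_square)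
      (simp add: q_def algebra_simps)
  then show "- (G (\<Theta> u) \<bullet> ?D) \<le> 0" by simp
qed auto

lemma flow_output_variance_bounded:
  "\<exists>K. \<forall>t\<ge>0. (\<Theta> t $ 3)\<^sup>2 * pvar (\<Theta> t $ 1) (\<Theta> t $ 2) \<le> K"
proof (intro exI allI impI)
  fix t :: real assume t: "0 \<le> t"
  let ?I = "integral {0..1} (\<lambda>s. (F s)\<^sup>2)"
  have "(\<Theta> t $ 3)\<^sup>2 * pvar (\<Theta> t $ 1) (\<Theta> t $ 2) \<le> 2 * (risk f (\<Theta> t) - ?I) + 4 * ?I"
    using output_variance_le[OF F_cont integral_centred[OF f_cont, folded F_def], of "\<Theta> t $ 3" "\<Theta> t $ 1" "\<Theta> t $ 2"]
    unfolding risk_eq[OF f_cont F_def] pvar_def by (simp add: algebra_simps)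
  also have "\<dots> \<le> 2 * (risk f (\<Theta> 0) - ?I) + 4 * ?I" using risk_flow_le[OF t] by simp
  finally show "(\<Theta> t $ 3)\<^sup>2 * pvar (\<Theta> t $ 1) (\<Theta> t $ 2) \<le> 2 * (risk f (\<Theta> 0) - ?I) + 4 * ?I" .
qed

lemma flow_bounded:
  assumes lip: "C-lipschitz_on {0..1} f"
  shows "\<exists>B. \<forall>t\<ge>0. norm (\<Theta> t) \<le> B"
proof -
  define q where "q t = \<Theta> t $ 2 * Lw F (\<Theta> t $ 1) (\<Theta> t $ 2) (\<Theta> t $ 3)
    - \<Theta> t $ 1 * Lb F (\<Theta> t $ 1) (\<Theta> t $ 2) (\<Theta> t $ 3)" for t
  obtain K where K: "\<forall>t\<ge>0. (\<Theta> t $ 3)\<^sup>2 * pvar (\<Theta> t $ 1) (\<Theta> t $ 2) \<le> K"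
    using flow_output_variance_bounded by blast
  have lipF: "\<bar>F s - F t\<bar> \<le> C * \<bar>s - t\<bar>" if "s \<in> {0..1}" "t \<in> {0..1}" for s t
    using lipschitz_onD[OF lip that] by (simp add: F_def dist_real_def)
  note iF = integral_centred[OF f_cont, folded F_def]
  have dw: "((\<lambda>t. \<Theta> t $ 1) has_real_derivative - (\<Theta> t $ 2 * q t)) (at t within {0..})"
    and db: "((\<lambda>t. \<Theta> t $ 2) has_real_derivative \<Theta> t $ 1 * q t) (at t within {0..})"
    and dc: "((\<lambda>t. \<Theta> t $ 3) has_real_derivative - Lc F (\<Theta> t $ 1) (\<Theta> t $ 2) (\<Theta> t $ 3)) (at t within {0..})"
    if "0 \<le> t" for t
    using flow_component_derivative[OF that flow_nonzero[OF that]] flow_tangential[OF that q_def]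
    by (metis minus_minus)+
  obtain B1 where B1: "\<forall>t\<ge>0. \<Theta> t $ 3 \<le> B1"
    using flow_upper_bound[OF F_cont iF lipF q_def dw db dc flow_on_circle] K by blast
  obtain B2 where B2: "\<forall>t\<ge>0. - (\<Theta> t $ 3) \<le> B2"
  proof -
    have "\<exists>B. \<forall>t\<ge>0. - (\<Theta> t $ 3) \<le> B"
    \<comment> \<open>The sign flip leaves \<open>w\<close>, \<open>b\<close>, \<open>q\<close> and
      \<open>c\<^sup>2\<close> as they are and negates only the equation for
      \<open>c\<close>.\<close>
    proof (rule flow_upper_bound[where F="\<lambda>s. - F s" and \<Lambda>=C and q=q and K=K and w="\<lambda>t. \<Theta> t $ 1" and b="\<lambda>t. \<Theta> t $ 2"])
      show "continuous_on {0..1} (\<lambda>s. - F s)" using F_cont by (intro continuous_intros)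
      show "integral {0..1} (\<lambda>s. - F s) = 0" using iF by simp
      show "\<bar>- F s - - F t\<bar> \<le> C * \<bar>s - t\<bar>" if "s \<in> {0..1}" "t \<in> {0..1}" for s t
        using lipF[OF that] by (simp add: abs_minus_commute)
      show "((\<lambda>t. - (\<Theta> t $ 3)) has_real_derivative
          - Lc (\<lambda>s. - F s) (\<Theta> t $ 1) (\<Theta> t $ 2) (- (\<Theta> t $ 3))) (at t within {0..})" if "0 \<le> t" for t
        unfolding partials_uminus by (rule DERIV_minus[OF dc[OF that]])
    qed (use K dw db flow_on_circle in \<open>simp_all add: partials_uminus q_def\<close>)
    then show thesis using that by blast
  qed
  have "norm (\<Theta> t) \<le> 2 + (\<bar>B1\<bar> + \<bar>B2\<bar>)" if t: "0 \<le> t" for t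
  proof -
    have "\<bar>\<Theta> t $ 1\<bar> \<le> 1" "\<bar>\<Theta> t $ 2\<bar> \<le> 1"
      using flow_on_circle[OF t] zero_le_power2[of "\<Theta> t $ 1"] zero_le_power2[of "\<Theta> t $ 2"]
      unfolding abs_square_le_1[symmetric] by linarith+
    moreover have "\<bar>\<Theta> t $ 3\<bar> \<le> \<bar>B1\<bar> + \<bar>B2\<bar>" using B1[rule_format, OF t] B2[rule_format, OF t] by linarith
    ultimately show ?thesis using norm_le_l1_cart[of "\<Theta> t"] by (simp add: sum_3)
  qed
  then show ?thesis by blast
qed

end

theorem theorem3p17:
  fixes f :: "real \<Rightarrow> real"
    and G :: "real^3 \<Rightarrow> real^3"
    and \<Theta> :: "real \<Rightarrow> real^3"
  assumes f_cont: "continuous_on {0..1} f"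
    and f_lipschitz: "\<exists>C. C-lipschitz_on {0..1} f"
    and G_locally_bounded: "locally_bounded G"
    and G_measurable: "G \<in> borel_measurable borel"
    and G_eq: "\<And>\<theta>. \<bar>\<theta>$1\<bar> + \<bar>\<theta>$2\<bar> > 0 \<Longrightarrow>
      G \<theta> = grad (risk f) \<theta>
        - (inverse ((norm (grad inner_sq \<theta>))\<^sup>2) * (grad (risk f) \<theta> \<bullet> grad inner_sq \<theta>))
            *\<^sub>R grad inner_sq \<theta>"
    and init: "\<Theta> 0 \<in> norm_manifold"
    and flow: "gradient_flow G \<Theta>"
  shows "(SUP t\<in>{0..}. ereal (norm (\<Theta> t))) < \<infinity>"
proof -
  obtain C where "C-lipschitz_on {0..1} f" using f_lipschitz by blast
  from flow_bounded[OF f_cont refl G_eq init flow this]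
  obtain B where "\<forall>t\<ge>0. norm (\<Theta> t) \<le> B" by blast
  \<comment> \<open>In \<open>ereal\<close> the supremum of an unbounded set is infinite, so the
    strict inequality expresses boundedness.\<close>
  then have "(SUP t\<in>{0..}. ereal (norm (\<Theta> t))) \<le> ereal B" by (intro SUP_least) auto
  then show ?thesis by (rule order_le_less_trans) simp
qed

end
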